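(* For every Coxeter system $(W,S)$, the language $\mathcal R(W^{FC})=\bigcup_{w\in W^{FC}}\mathcal R(w)\subseteq S^*$ of all reduced expressions of fully commutative elements is a regular language over the alphabet $S$ (i.e. it is recognized by a finite deterministic automaton).
   Context: Coxeter system $(W,S)$: finite $S$, symmetric $(m_{st})$ with $m_{ss}=1$, $m_{st}\in\{2,3,\dots\}\cup\{\infty\}$ for $s\ne t$, $W=\langle S\mid (st)^{m_{st}}=1,\ m_{st}<\infty\rangle$. $\mathcal R(w)$ is the set of reduced expressions of $w$ (words in $S$ of minimal length representing $w$). $w$ is fully commutative if $\mathcal R(w)$ is a single class for the equivalence on $S^*$ generated by $\mathbf u st\mathbf v\sim\mathbf u ts\mathbf v$ when $m_{st}=2$; $W^{FC}$ is the set of such elements. *)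

theory Defs
  imports Main "HOL-Library.Extended_Nat"
begin

definition coxeter_matrix :: "'a set \<Rightarrow> ('a \<Rightarrow> 'a \<Rightarrow> enat) \<Rightarrow> bool" where
  "coxeter_matrix S m \<longleftrightarrow> finite S \<and> (\<forall>s\<in>S. m s s = 1)
     \<and> (\<forall>s\<in>S. \<forall>t\<in>S. m s t = m t s)
     \<and> (\<forall>s\<in>S. \<forall>t\<in>S. s \<noteq> t \<longrightarrow> m s t \<ge> 2)"

fun alt :: "'a \<Rightarrow> 'a \<Rightarrow> nat \<Rightarrow> 'a list" where
  "alt s t 0 = []"
| "alt s t (Suc n) = s # alt t s n"

text \<open>Two words over S represent the same element of W = <S | (st)^m_st = 1>:
  the congruence on S* generated by the relators (st)^(m_st) (m_st finite);
  since m_ss = 1 this includes ss = 1, so the monoid quotient is the group W.\<close>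
inductive coxeter_eq :: "'a set \<Rightarrow> ('a \<Rightarrow> 'a \<Rightarrow> enat) \<Rightarrow> 'a list \<Rightarrow> 'a list \<Rightarrow> bool"
  for S m where
  refl: "w \<in> lists S \<Longrightarrow> coxeter_eq S m w w"
| sym: "coxeter_eq S m u w \<Longrightarrow> coxeter_eq S m w u"
| trans: "coxeter_eq S m u v \<Longrightarrow> coxeter_eq S m v w \<Longrightarrow> coxeter_eq S m u w"
| rel: "s \<in> S \<Longrightarrow> t \<in> S \<Longrightarrow> m s t = enat k \<Longrightarrow> u \<in> lists S \<Longrightarrow> v \<in> lists S
        \<Longrightarrow> coxeter_eq S m (u @ alt s t (2 * k) @ v) (u @ v)"

definition reduced :: "'a set \<Rightarrow> ('a \<Rightarrow> 'a \<Rightarrow> enat) \<Rightarrow> 'a list \<Rightarrow> bool" where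
  "reduced S m w \<longleftrightarrow> w \<in> lists S \<and> (\<forall>u. coxeter_eq S m u w \<longrightarrow> length w \<le> length u)"

definition comm_step :: "('a \<Rightarrow> 'a \<Rightarrow> enat) \<Rightarrow> 'a list \<Rightarrow> 'a list \<Rightarrow> bool" where
  "comm_step m x y \<longleftrightarrow> (\<exists>u v s t. m s t = 2 \<and> x = u @ [s, t] @ v \<and> y = u @ [t, s] @ v)"

definition comm_eq :: "('a \<Rightarrow> 'a \<Rightarrow> enat) \<Rightarrow> 'a list \<Rightarrow> 'a list \<Rightarrow> bool" where
  "comm_eq m = (comm_step m)\<^sup>*\<^sup>*"

text \<open>R(W^FC): reduced words w whose element has all its reduced expressions
  in one commutation class (the class of w).\<close>
definition FC_reduced_words :: "'a set \<Rightarrow> ('a \<Rightarrow> 'a \<Rightarrow> enat) \<Rightarrow> 'a list set" where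
  "FC_reduced_words S m = {w. reduced S m w \<and>
      (\<forall>u. reduced S m u \<and> coxeter_eq S m u w \<longrightarrow> comm_eq m u w)}"

definition regular_lang :: "'a set \<Rightarrow> 'a list set \<Rightarrow> bool" where
  "regular_lang \<Sigma> L \<longleftrightarrow> (\<exists>(Q :: nat set) q0 (\<delta> :: nat \<Rightarrow> 'a \<Rightarrow> nat) F.
      finite Q \<and> q0 \<in> Q \<and> F \<subseteq> Q \<and> (\<forall>q\<in>Q. \<forall>a\<in>\<Sigma>. \<delta> q a \<in> Q) \<and>
      L = {w \<in> lists \<Sigma>. foldl \<delta> q0 w \<in> F})"

end

theory Submission
  imports Defs Complex_Main
begin

text \<open>
  Tits' parity argument: the number of reflections
  \<open>w\<^sub>1 \<dots> w\<^sub>i\<^sub>-\<^sub>1 w\<^sub>i w\<^sub>i\<^sub>-\<^sub>1 \<dots> w\<^sub>1\<close> of a word \<open>w\<close> that equal a given element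
  of \<open>W\<close> has a parity depending only on the element represented by \<open>w\<close>. Hence a word is
  reduced iff its reflections are pairwise distinct, which gives the deletion and exchange
  conditions, Matsumoto's theorem (reduced expressions of one element are connected by braid
  moves) and Tits' solution of the word problem (a non-reduced word braids into one containing
  \<open>s s\<close>). The geometric representation shows that \<open>s t\<close> has order exactly \<open>m\<^sub>s\<^sub>t\<close>.

  Consequently a word is a reduced expression of a fully commutative element iff no word
  commutation equivalent to it contains a factor \<open>s s\<close> or a braid factor \<open>s t s \<dots>\<close> of
  length \<open>m\<^sub>s\<^sub>t \<ge> 3\<close>. There are finitely many such factors, and this property is
  recognised by a finite automaton that remembers, for every prefix \<open>g\<close> of a forbidden
  factor, which sets of letters can follow an occurrence of \<open>g\<close> in a word commutation
  equivalent to the input read so far.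
\<close>

section \<open>Alternating words and deletion\<close>

lemma rev_in_lists [simp]: "rev x \<in> lists A \<longleftrightarrow> x \<in> lists A"
  by auto

lemma alt_add: "alt s t (a + b) = alt s t a @ (if even a then alt s t b else alt t s b)"
  by (induction a arbitrary: s t) auto

lemma length_alt [simp]: "length (alt s t n) = n"
  by (induction n arbitrary: s t) auto

lemma set_alt: "set (alt s t n) \<subseteq> {s, t}"
  by (induction n arbitrary: s t) auto

lemma rev_alt: "rev (alt t s k) = (if even k then alt s t k else alt t s k)"
proof (induction k arbitrary: s t)
  case 0
  then show ?case by simp
next
  case (Suc k)
  have "alt t s (Suc k) = alt t s k @ (if even k then [t] else [s])"
    using alt_add[of t s k 1] by simp
  then show ?case
    using Suc[of s t] Suc[of t s] by (auto simp: alt_add[of _ _ 1 k, simplified])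
qed

lemma alt_double: "alt s t (2 * k) = alt s t k @ rev (alt t s k)"
  using alt_add[of s t k k] by (simp add: rev_alt mult_2)

lemma alt_Suc_double: "alt s t (2 * Suc j) = alt s t (2 * j) @ [s, t]"
  by (induction j) (auto simp: numeral_2_eq_2)

lemma alt_odd_snoc: "alt s t (2 * i + 1) @ [t] = alt s t (2 * Suc i)"
  using alt_add[of s t "2 * i + 1" 1] by simp

lemma take_alt: "i \<le> n \<Longrightarrow> take i (alt s t n) = alt s t i"
  using alt_add[of s t i "n - i"] by simp

lemma nth_alt: "i < n \<Longrightarrow> alt s t n ! i = (if even i then s else t)"
  by (induction n arbitrary: i s t) (auto simp: nth_Cons split: nat.split)

lemma alt_odd_palindrome:
  "alt s t i @ [if even i then s else t] @ rev (alt s t i) = alt s t (2 * i + 1)"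
  using alt_add[of s t i "Suc i"] rev_alt[of s t i] rev_alt[of t s i]
  by (auto simp: mult_2)

lemma alt_adjacent: "alt s t n = p @ [a, b] @ q \<Longrightarrow> (a = s \<and> b = t) \<or> (a = t \<and> b = s)"
proof (induction n arbitrary: s t p)
  case 0
  then show ?case by simp
next
  case (Suc n)
  show ?case
  proof (cases p)
    case Nil
    then show ?thesis using Suc.prems by (cases n) auto
  next
    case (Cons c p')
    then show ?thesis using Suc by auto
  qed
qed

lemma alt_if_no_square:
  assumes "s \<noteq> t"
  shows "a \<in> lists {s, t} \<Longrightarrow> \<forall>p q y. a \<noteq> p @ [y, y] @ q
    \<Longrightarrow> a = alt s t (length a) \<or> a = alt t s (length a)"
proof (induction a)
  case Nil
  then show ?case by simp
next
  case (Cons x a)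
  have IH: "a = alt s t (length a) \<or> a = alt t s (length a)"
    using Cons by (metis append_Cons listsE)
  show ?case
  proof (cases a)
    case (Cons y a')
    then have "x \<noteq> y" using Cons.prems by (metis append_Nil append_Cons)
    then show ?thesis using IH Cons Cons.prems assms by (cases "length a") auto
  qed (use Cons.prems in auto)
qed

definition del_nth :: "'a list \<Rightarrow> nat \<Rightarrow> 'a list" where
  "del_nth w i = take i w @ drop (Suc i) w"

lemma length_del_nth: "i < length w \<Longrightarrow> length (del_nth w i) = length w - 1"
  unfolding del_nth_def by simp

lemma set_del_nth: "set (del_nth w i) \<subseteq> set w"
  unfolding del_nth_def using set_take_subset set_drop_subset by fastforce

lemma del_nth_in_lists: "w \<in> lists A \<Longrightarrow> del_nth w i \<in> lists A"
  using set_del_nth[of w i] by auto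

lemma del_nth_append:
  "del_nth (a @ z) i = (if i < length a then del_nth a i @ z else a @ del_nth z (i - length a))"
proof (cases "i < length a")
  case False
  then have "Suc i - length a = Suc (i - length a)" by simp
  with False show ?thesis unfolding del_nth_def by simp
qed (simp add: del_nth_def)

section \<open>The word problem of a Coxeter system\<close>

locale coxeter_system =
  fixes S :: "'a set" and m :: "'a \<Rightarrow> 'a \<Rightarrow> enat"
  assumes coxeter_matrix: "coxeter_matrix S m"
begin

abbreviation ceq :: "'a list \<Rightarrow> 'a list \<Rightarrow> bool" where "ceq \<equiv> coxeter_eq S m"

lemma finite_S: "finite S"
  using coxeter_matrix unfolding coxeter_matrix_def by auto

lemma m_diag: "s \<in> S \<Longrightarrow> m s s = 1"
  using coxeter_matrix unfolding coxeter_matrix_def by auto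

lemma m_sym: "s \<in> S \<Longrightarrow> t \<in> S \<Longrightarrow> m s t = m t s"
  using coxeter_matrix unfolding coxeter_matrix_def by auto

lemma m_ge_2: "s \<in> S \<Longrightarrow> t \<in> S \<Longrightarrow> s \<noteq> t \<Longrightarrow> m s t \<ge> 2"
  using coxeter_matrix unfolding coxeter_matrix_def by auto

lemma m_enat_ge_2: "s \<in> S \<Longrightarrow> t \<in> S \<Longrightarrow> s \<noteq> t \<Longrightarrow> m s t = enat k \<Longrightarrow> k \<ge> 2"
  using m_ge_2 by (fastforce simp: numeral_eq_enat)

lemma m_eq_2_neq: "s \<in> S \<Longrightarrow> t \<in> S \<Longrightarrow> m s t = 2 \<Longrightarrow> s \<noteq> t"
  using m_diag by (auto simp: one_enat_def numeral_eq_enat)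

lemma alt_in_lists: "s \<in> S \<Longrightarrow> t \<in> S \<Longrightarrow> alt s t n \<in> lists S"
  using set_alt[of s t n] by auto

lemma ceq_in_lists: "ceq u w \<Longrightarrow> u \<in> lists S \<and> w \<in> lists S"
  by (induction rule: coxeter_eq.induct) (auto dest: set_alt[THEN subsetD])

lemmas ceq_refl = coxeter_eq.refl[where S = S and m = m]
lemmas ceq_sym = coxeter_eq.sym[where S = S and m = m]
lemmas ceq_trans = coxeter_eq.trans[where S = S and m = m]

lemma ceq_cong: "ceq u w \<Longrightarrow> p \<in> lists S \<Longrightarrow> q \<in> lists S \<Longrightarrow> ceq (p @ u @ q) (p @ w @ q)"
proof (induction rule: coxeter_eq.induct)
  case (refl w)
  then show ?case by (intro ceq_refl) auto
next
  case (rel s t k u v)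
  from coxeter_eq.rel[of s S t m k "p @ u" "v @ q"] rel show ?case by simp
qed (auto intro: ceq_sym ceq_trans)

lemma ceq_cong_left: "ceq u w \<Longrightarrow> p \<in> lists S \<Longrightarrow> ceq (p @ u) (p @ w)"
  using ceq_cong[of u w p "[]"] by simp

lemma ceq_cong_right: "ceq u w \<Longrightarrow> q \<in> lists S \<Longrightarrow> ceq (u @ q) (w @ q)"
  using ceq_cong[of u w "[]" q] by simp

lemma ceq_append: "ceq u u' \<Longrightarrow> ceq w w' \<Longrightarrow> ceq (u @ w) (u' @ w')"
  by (meson ceq_cong_left ceq_cong_right ceq_in_lists ceq_trans)

lemma ceq_square: "s \<in> S \<Longrightarrow> ceq [s, s] []"
  using coxeter_eq.rel[of s S s m 1 "[]" "[]"] by (simp add: m_diag one_enat_def numeral_2_eq_2)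

lemma ceq_delete_square: "p \<in> lists S \<Longrightarrow> q \<in> lists S \<Longrightarrow> s \<in> S \<Longrightarrow> ceq (p @ [s, s] @ q) (p @ q)"
  using ceq_cong[OF ceq_square] by fastforce

lemma ceq_rev_append: "x \<in> lists S \<Longrightarrow> ceq (rev x @ x) []"
proof (induction x)
  case Nil
  then show ?case by (simp add: ceq_refl)
next
  case (Cons a x)
  have "ceq (rev x @ [a, a] @ x) (rev x @ x)"
    using Cons by (intro ceq_delete_square) auto
  then show ?case using Cons by (auto intro: ceq_trans)
qed

lemma ceq_append_rev: "x \<in> lists S \<Longrightarrow> ceq (x @ rev x) []"
  using ceq_rev_append[of "rev x"] by simp

lemma ceq_cancel_left: "ceq (p @ u) (p @ w) \<Longrightarrow> p \<in> lists S \<Longrightarrow> ceq u w"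
proof -
  assume a: "ceq (p @ u) (p @ w)" and p: "p \<in> lists S"
  have "ceq (rev p @ p @ u) (rev p @ p @ w)" using ceq_cong_left[OF a, of "rev p"] p by simp
  moreover have "ceq ((rev p @ p) @ v) v" if "v \<in> lists S" for v
    using ceq_cong_right[OF ceq_rev_append[OF p] that] by simp
  ultimately show ?thesis
    using ceq_in_lists[OF a] by (metis append.assoc append_in_lists_conv ceq_sym ceq_trans)
qed

lemma ceq_conj_iff: "x \<in> lists S \<Longrightarrow> ceq (x @ T @ rev x) r \<longleftrightarrow> ceq T (rev x @ r @ x)"
proof -
  assume x: "x \<in> lists S"
  have conj: "ceq (rev y @ (y @ v @ rev y) @ y) v" if "y \<in> lists S" "v \<in> lists S" for y v
    using ceq_append[OF ceq_rev_append[OF that(1)] ceq_append[OF ceq_refl[OF that(2)] ceq_rev_append[OF that(1)]]]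
    by simp
  show ?thesis
  proof
    assume h: "ceq (x @ T @ rev x) r"
    have "ceq (rev x @ (x @ T @ rev x) @ x) (rev x @ r @ x)"
      using ceq_cong[OF h, of "rev x" x] x by simp
    then show "ceq T (rev x @ r @ x)"
      using conj[OF x] ceq_in_lists[OF h] by (meson append_in_lists_conv ceq_sym ceq_trans)
  next
    assume h: "ceq T (rev x @ r @ x)"
    have "ceq (x @ T @ rev x) (rev (rev x) @ (rev x @ r @ rev (rev x)) @ rev x)"
      using ceq_cong[OF h, of x "rev x"] x by simp
    then show "ceq (x @ T @ rev x) r"
      using conj[of "rev x" r] x ceq_in_lists[OF h] by (meson append_in_lists_conv ceq_trans rev_in_lists)
  qed
qed

lemma ceq_alt_relation: "s \<in> S \<Longrightarrow> t \<in> S \<Longrightarrow> m s t = enat k \<Longrightarrow> ceq (alt s t (2 * k)) []"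
  using coxeter_eq.rel[of s S t m k "[]" "[]"] by simp

lemma ceq_braid: "s \<in> S \<Longrightarrow> t \<in> S \<Longrightarrow> m s t = enat k \<Longrightarrow> ceq (alt s t k) (alt t s k)"
proof -
  assume st: "s \<in> S" "t \<in> S" and mk: "m s t = enat k"
  let ?A = "alt s t k" and ?B = "alt t s k"
  have B: "?B \<in> lists S" using alt_in_lists st by auto
  have "ceq (?A @ rev ?B @ ?B) ?A"
    using ceq_cong_left[OF ceq_rev_append[OF B], of ?A] alt_in_lists st by simp
  moreover have "ceq ((?A @ rev ?B) @ ?B) ?B"
    using ceq_cong_right[OF ceq_alt_relation[OF st mk] B] by (simp add: alt_double)
  ultimately show ?thesis by (metis append.assoc ceq_sym ceq_trans)
qed

lemma ceq_alt_Suc: assumes "s \<in> S" "t \<in> S" "m s t = enat M"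
  shows "ceq (alt s t (Suc M)) (alt t s (M - 1))"
proof -
  have M: "M \<ge> 1"
    using assms m_diag m_enat_ge_2[of s t M] by (cases "s = t") (auto simp: one_enat_def)
  have l: "alt s t M = s # alt t s (M - 1)" using M by (cases M) auto
  have "ceq ([s] @ alt t s M @ []) ([s] @ alt s t M @ [])"
    using ceq_braid[of t s M] assms m_sym by (intro ceq_cong) auto
  then have "ceq (alt s t (Suc M)) ([] @ [s, s] @ alt t s (M - 1))" unfolding l by simp
  then show ?thesis
    using ceq_delete_square[of "[]" "alt t s (M - 1)" s] assms alt_in_lists ceq_trans by fastforce
qed

end

section \<open>Reflections of a word and the deletion condition\<close>

lemma sum_lessThan_add: "(\<Sum>i<a + b. f i) = (\<Sum>i<a. f i) + (\<Sum>j<b. f (a + j))"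
  for f :: "nat \<Rightarrow> 'b :: comm_monoid_add"
  by (induction b) (auto simp: add.assoc)

definition refl_word :: "'a list \<Rightarrow> nat \<Rightarrow> 'a list" where
  "refl_word w i = take i w @ [w ! i] @ rev (take i w)"

lemma refl_word_Cons_0: "refl_word (a # w) 0 = [a]"
  unfolding refl_word_def by simp

lemma refl_word_alt: "i < n \<Longrightarrow> refl_word (alt s t n) i = alt s t (2 * i + 1)"
  unfolding refl_word_def take_alt[OF less_imp_le] nth_alt by (rule alt_odd_palindrome)

lemma refl_word_append_left: "i < length x \<Longrightarrow> refl_word (x @ y) i = refl_word x i"
  unfolding refl_word_def by (simp add: nth_append)

lemma refl_word_append_right: "refl_word (x @ y) (length x + j) = x @ refl_word y j @ rev x"
  unfolding refl_word_def by (simp add: nth_append)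

lemma refl_word_del_nth: "i < j \<Longrightarrow> j < length w \<Longrightarrow> refl_word (del_nth w j) i = refl_word w i"
  unfolding refl_word_def del_nth_def by (simp add: nth_append min_def)

lemma refl_word_in_lists: "w \<in> lists A \<Longrightarrow> i < length w \<Longrightarrow> refl_word w i \<in> lists A"
  unfolding refl_word_def by (auto dest: in_set_takeD)

context coxeter_system
begin

definition refl_count :: "'a list \<Rightarrow> 'a list \<Rightarrow> nat" where
  "refl_count w r = (\<Sum>i<length w. if ceq (refl_word w i) r then 1 else 0)"

lemma refl_count_cong: "ceq r r' \<Longrightarrow> refl_count w r = refl_count w r'"
  unfolding refl_count_def by (meson ceq_sym ceq_trans)

lemma refl_count_not_in_lists: "r \<notin> lists S \<Longrightarrow> refl_count w r = 0"
  unfolding refl_count_def using ceq_in_lists by auto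

lemma refl_count_nonzero: "refl_count w r \<noteq> 0 \<Longrightarrow> \<exists>j<length w. ceq (refl_word w j) r"
  unfolding refl_count_def by (rule ccontr) (simp add: sum.neutral)

lemma refl_count_append: "refl_count (x @ y) r = refl_count x r + refl_count y (rev x @ r @ x)"
proof (cases "x \<in> lists S")
  case True
  then show ?thesis
    unfolding refl_count_def length_append sum_lessThan_add
    by (simp add: refl_word_append_left refl_word_append_right ceq_conj_iff)
next
  case False
  have "\<not> ceq (x @ T @ rev x) r" "\<not> ceq T (rev x @ r @ x)" for T
    using False ceq_in_lists by fastforce+
  then show ?thesis
    unfolding refl_count_def length_append sum_lessThan_add
    by (simp add: refl_word_append_left refl_word_append_right)
qed

lemma even_refl_count_relation:
  assumes "s \<in> S" "t \<in> S" "m s t = enat k"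
  shows "even (refl_count (alt s t (2 * k)) r)"
proof -
  define f where "f i = (if ceq (alt s t (2 * i + 1)) r then 1 else 0 :: nat)" for i
  have periodic: "f (k + j) = f j" for j
  proof -
    have "alt s t (2 * (k + j) + 1) = alt s t (2 * k) @ alt s t (2 * j + 1)"
      using alt_add[of s t "2 * k" "2 * j + 1"] by (simp add: algebra_simps)
    moreover have "ceq (alt s t (2 * k) @ alt s t (2 * j + 1)) (alt s t (2 * j + 1))"
      using ceq_cong_right[OF ceq_alt_relation[OF assms]] alt_in_lists assms by simp
    ultimately show ?thesis unfolding f_def by (metis ceq_sym ceq_trans)
  qed
  have "refl_count (alt s t (2 * k)) r = (\<Sum>i<k + k. f i)"
    unfolding refl_count_def f_def by (intro sum.cong) (auto simp: refl_word_alt)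
  also have "\<dots> = 2 * (\<Sum>i<k. f i)"
    unfolding sum_lessThan_add periodic by simp
  finally show ?thesis by simp
qed

lemma odd_refl_count_cong: "ceq u w \<Longrightarrow> odd (refl_count u r) \<longleftrightarrow> odd (refl_count w r)"
proof (induction arbitrary: r rule: coxeter_eq.induct)
  case (rel s t k u v)
  let ?A = "alt s t (2 * k)"
  define r' where "r' = rev u @ r @ u"
  have "refl_count v (rev ?A @ r' @ ?A) = refl_count v r'"
  proof (cases "r' \<in> lists S")
    case True
    have "rev ?A = alt t s (2 * k)" using rev_alt[of s t "2 * k"] by simp
    then have "ceq (rev ?A) []" using ceq_alt_relation[of t s k] rel m_sym by auto
    then have "ceq (rev ?A @ r' @ ?A) ([] @ r' @ [])"
      using ceq_append ceq_refl[OF True] ceq_alt_relation[OF rel(1-3)] by blast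
    then show ?thesis using refl_count_cong by simp
  qed (simp add: refl_count_not_in_lists)
  moreover have "even (refl_count ?A r')" using even_refl_count_relation rel by blast
  ultimately show ?case unfolding refl_count_append r'_def by simp
qed auto

lemma ceq_refl_word_append:
  assumes "w \<in> lists S" "i < length w"
  shows "ceq (refl_word w i @ w) (del_nth w i)"
proof -
  let ?P = "take i w" and ?Q = "drop (Suc i) w" and ?a = "w ! i"
  have w: "w = ?P @ [?a] @ ?Q" using id_take_nth_drop[OF assms(2)] by simp
  have l: "?P \<in> lists S" "?Q \<in> lists S" "?a \<in> S"
    using assms by (auto dest: in_set_takeD in_set_dropD)
  have "ceq ((?P @ [?a]) @ (rev ?P @ ?P) @ ([?a] @ ?Q)) ((?P @ [?a]) @ [] @ ([?a] @ ?Q))"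
    using l by (intro ceq_cong ceq_rev_append) auto
  then have "ceq (refl_word w i @ w) (?P @ [?a, ?a] @ ?Q)"
    unfolding refl_word_def by (subst w) simp
  then show ?thesis
    unfolding del_nth_def using ceq_delete_square[OF l] ceq_trans by blast
qed

lemma ceq_refl_word_del_nth:
  assumes "w \<in> lists S" "i < length w"
  shows "ceq w (refl_word w i @ del_nth w i)"
proof -
  let ?T = "refl_word w i"
  have T: "?T \<in> lists S" using refl_word_in_lists[OF assms] .
  have "ceq (?T @ ?T @ w) (?T @ del_nth w i)"
    using ceq_cong_left[OF ceq_refl_word_append[OF assms] T] .
  moreover have "?T @ ?T @ w = (?T @ rev ?T) @ w" unfolding refl_word_def by simp
  moreover have "ceq ((?T @ rev ?T) @ w) w"
    using ceq_cong_right[OF ceq_append_rev[OF T] assms(1)] by simp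
  ultimately show ?thesis by (metis ceq_sym ceq_trans)
qed

lemma deletion_condition:
  assumes "w \<in> lists S" "i < j" "j < length w" "ceq (refl_word w i) (refl_word w j)"
  shows "ceq w (del_nth (del_nth w j) i)"
proof -
  have "ceq w (refl_word w j @ del_nth w j)"
    using ceq_refl_word_del_nth assms by auto
  moreover have "ceq (refl_word w j @ del_nth w j) (refl_word (del_nth w j) i @ del_nth w j)"
    using ceq_cong_right[OF ceq_sym[OF assms(4)]] del_nth_in_lists[OF assms(1)]
    by (simp add: refl_word_del_nth assms)
  moreover have "ceq (refl_word (del_nth w j) i @ del_nth w j) (del_nth (del_nth w j) i)"
    using ceq_refl_word_append[OF del_nth_in_lists[OF assms(1)]] assms length_del_nth[of j w] by auto
  ultimately show ?thesis by (metis ceq_trans)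
qed

lemma reduced_in_lists: "reduced S m w \<Longrightarrow> w \<in> lists S"
  unfolding reduced_def by auto

lemma reduced_length_eq: "reduced S m u \<Longrightarrow> reduced S m w \<Longrightarrow> ceq u w \<Longrightarrow> length u = length w"
  unfolding reduced_def by (meson ceq_sym le_antisym)

lemma reduced_ceq_same_length: "reduced S m u \<Longrightarrow> ceq u w \<Longrightarrow> length w = length u \<Longrightarrow> reduced S m w"
  unfolding reduced_def by (metis ceq_in_lists ceq_sym ceq_trans)

lemma reduced_Nil: "reduced S m []"
  unfolding reduced_def by auto

lemma reduced_appendD:
  assumes "reduced S m (u @ w)"
  shows "reduced S m u" "reduced S m w"
proof -
  have l: "u \<in> lists S" "w \<in> lists S" using reduced_in_lists[OF assms] by auto
  show "reduced S m u"
    unfolding reduced_def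
    using assms l ceq_cong_right[OF _ l(2)] unfolding reduced_def by fastforce
  show "reduced S m w"
    unfolding reduced_def
    using assms l ceq_cong_left[OF _ l(1)] unfolding reduced_def by fastforce
qed

lemma reduced_refl_words_distinct:
  assumes "reduced S m w" "i < j" "j < length w"
  shows "\<not> ceq (refl_word w i) (refl_word w j)"
proof
  assume "ceq (refl_word w i) (refl_word w j)"
  then have "ceq w (del_nth (del_nth w j) i)"
    using deletion_condition assms reduced_in_lists by blast
  moreover have "length (del_nth (del_nth w j) i) < length w"
    using assms by (simp add: length_del_nth)
  ultimately show False using assms(1) unfolding reduced_def by (meson ceq_sym not_le)
qed

lemma refl_count_refl_word:
  assumes "w \<in> lists S" "i < length w"
    and distinct: "\<And>i j. i < j \<Longrightarrow> j < length w \<Longrightarrow> \<not> ceq (refl_word w i) (refl_word w j)"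
  shows "refl_count w (refl_word w i) = 1"
proof -
  have "j = i" if "j < length w" "ceq (refl_word w j) (refl_word w i)" for j
    using distinct[of i j] distinct[of j i] that assms(2) ceq_sym by (metis linorder_neqE_nat)
  then have "{..<length w} \<inter> {j. ceq (refl_word w j) (refl_word w i)} = {i}"
    using assms ceq_refl[OF refl_word_in_lists[OF assms(1,2)]] by auto
  then show ?thesis unfolding refl_count_def by (simp add: sum.If_cases)
qed

lemma refl_word_transfer:
  assumes "w \<in> lists S" "ceq w w'" "i < length w"
    and distinct: "\<And>i j. i < j \<Longrightarrow> j < length w \<Longrightarrow> \<not> ceq (refl_word w i) (refl_word w j)"
  shows "\<exists>j<length w'. ceq (refl_word w' j) (refl_word w i)"
proof -
  have "odd (refl_count w' (refl_word w i))"
    using odd_refl_count_cong[OF assms(2)] refl_count_refl_word[OF assms(1,3) distinct]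
    by (metis odd_one)
  then have "refl_count w' (refl_word w i) \<noteq> 0" by (metis even_zero)
  then show ?thesis by (rule refl_count_nonzero)
qed

lemma reduced_refl_word_transfer:
  assumes "reduced S m w" "ceq w w'" "i < length w" "ceq (refl_word w i) r"
  shows "\<exists>j<length w'. ceq (refl_word w' j) r"
  using refl_word_transfer[OF reduced_in_lists[OF assms(1)] assms(2,3)]
    reduced_refl_words_distinct[OF assms(1)] assms(4) by (meson ceq_trans)

text \<open>Distinct reflections of \<open>w\<close> reappear among the reflections of any other word for
  the same element, so that word is at least as long.\<close>

lemma reduced_if_refl_words_distinct:
  assumes w: "w \<in> lists S"
    and distinct: "\<And>i j. i < j \<Longrightarrow> j < length w \<Longrightarrow> \<not> ceq (refl_word w i) (refl_word w j)"
  shows "reduced S m w"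
  unfolding reduced_def
proof (intro conjI allI impI w)
  fix u assume "ceq u w"
  define f where "f i = (SOME j. j < length u \<and> ceq (refl_word u j) (refl_word w i))" for i
  have f: "f i < length u \<and> ceq (refl_word u (f i)) (refl_word w i)" if "i < length w" for i
    unfolding f_def
    by (rule someI_ex) (use refl_word_transfer[OF w ceq_sym[OF \<open>ceq u w\<close>] that distinct] in blast)
  have "inj_on f {..<length w}"
  proof (rule inj_onI)
    fix i i' assume ii': "i \<in> {..<length w}" "i' \<in> {..<length w}" "f i = f i'"
    then have "ceq (refl_word w i) (refl_word w i')"
      using f[of i] f[of i'] ceq_sym ceq_trans unfolding lessThan_iff by metis
    then show "i = i'" using distinct[of i i'] distinct[of i' i] ii' ceq_sym
      unfolding lessThan_iff by (metis linorder_neqE_nat)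
  qed
  moreover have "f ` {..<length w} \<subseteq> {..<length u}" using f by auto
  ultimately show "length w \<le> length u"
    using card_inj_on_le[of f "{..<length w}" "{..<length u}"] by simp
qed

end

section \<open>The geometric representation and dihedral subgroups\<close>

lemma sin_recurrence:
  fixes p q x :: real
  assumes "p + q = 1 \<or> p + q = -1"
  shows "sin (p * x) + 2 * cos x * sin (q * x) = sin ((p + 2 * q) * x)"
proof (cases "p + q = 1")
  case True
  then have p: "p = 1 - q" by simp
  show ?thesis unfolding p by (simp add: algebra_simps sin_add sin_diff left_diff_distrib)
next
  case False
  then have p: "p = -1 - q" using assms by simp
  show ?thesis unfolding p by (simp add: algebra_simps sin_add sin_diff left_diff_distrib)
qed

text \<open>With \<open>c = - B(e\<^sub>s, e\<^sub>t)\<close>, this is the effect of \<open>\<sigma>\<^sub>s \<sigma>\<^sub>t\<close> on the pair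
  \<open>(B(e\<^sub>s, f), B(e\<^sub>t, f))\<close>.\<close>

definition form_pair_step :: "real \<Rightarrow> real \<times> real \<Rightarrow> real \<times> real" where
  "form_pair_step c z = (- (fst z + 2 * c * snd z), - snd z + 2 * c * (fst z + 2 * c * snd z))"

lemma form_pair_step_linear:
  "(form_pair_step c ^^ j) (a * x1 + b * x2, a * y1 + b * y2) =
   (a * fst ((form_pair_step c ^^ j) (x1, y1)) + b * fst ((form_pair_step c ^^ j) (x2, y2)),
    a * snd ((form_pair_step c ^^ j) (x1, y1)) + b * snd ((form_pair_step c ^^ j) (x2, y2)))"
proof (induction j)
  case (Suc j)
  then show ?case by (simp add: form_pair_step_def algebra_simps)
qed simp

lemma form_pair_step_sin:
  fixes p q th :: real
  assumes "p + q = 1 \<or> p + q = -1"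
  shows "form_pair_step (cos th) (sin (p * th), sin (q * th)) =
    (sin ((- p - 2 * q) * th), sin ((2 * p + 3 * q) * th))"
proof -
  have 1: "sin (p * th) + 2 * cos th * sin (q * th) = sin ((p + 2 * q) * th)"
    using sin_recurrence assms by blast
  have 2: "sin ((- q) * th) + 2 * cos th * sin ((p + 2 * q) * th) = sin ((2 * p + 3 * q) * th)"
    using sin_recurrence[of "- q" "p + 2 * q" th] assms by (auto simp: algebra_simps)
  have "(- p - 2 * q) * th = - ((p + 2 * q) * th)" by (simp add: algebra_simps)
  then show ?thesis
    using 1 2 unfolding form_pair_step_def by simp
qed

lemma form_pair_step_iterate_1:
  "(form_pair_step (cos th) ^^ j) (sin th, 0) = (sin ((1 - 2 * real j) * th), sin ((2 * real j) * th))"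
proof (induction j)
  case (Suc j)
  have "(form_pair_step (cos th) ^^ Suc j) (sin th, 0)
      = form_pair_step (cos th) (sin ((1 - 2 * real j) * th), sin ((2 * real j) * th))"
    using Suc by simp
  also have "\<dots> = (sin ((- (1 - 2 * real j) - 2 * (2 * real j)) * th),
      sin ((2 * (1 - 2 * real j) + 3 * (2 * real j)) * th))"
    by (rule form_pair_step_sin) simp
  finally show ?case by (simp add: algebra_simps)
qed simp

lemma form_pair_step_iterate_2:
  "(form_pair_step (cos th) ^^ j) (0, sin th) = (sin ((- 2 * real j) * th), sin ((2 * real j + 1) * th))"
proof (induction j)
  case (Suc j)
  have "(form_pair_step (cos th) ^^ Suc j) (0, sin th)
      = form_pair_step (cos th) (sin ((- 2 * real j) * th), sin ((2 * real j + 1) * th))"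
    using Suc by simp
  also have "\<dots> = (sin ((- (- 2 * real j) - 2 * (2 * real j + 1)) * th),
      sin ((2 * (- 2 * real j) + 3 * (2 * real j + 1)) * th))"
    by (rule form_pair_step_sin) simp
  finally show ?case by (simp add: algebra_simps)
qed simp

lemma cos_pi_div_bounds:
  assumes "k \<ge> 2"
  shows "0 \<le> cos (pi / real k)" "cos (pi / real k) < 1"
proof -
  have pos: "0 < pi / real k" using assms by simp
  have le: "pi / real k \<le> pi / 2" using assms by (intro divide_left_mono) auto
  show "0 \<le> cos (pi / real k)" using pos le by (intro cos_ge_zero) auto
  show "cos (pi / real k) < 1" using cos_monotone_0_pi[of 0 "pi / real k"] pos le by auto
qed

text \<open>Rotation by \<open>2\<pi>/k\<close> in the basis \<open>(sin \<theta>, 0), (0, sin \<theta>)\<close>, \<open>\<theta> = \<pi>/k\<close>.\<close>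

lemma form_pair_step_period:
  assumes "k \<ge> 2"
  shows "(form_pair_step (cos (pi / real k)) ^^ k) z = z"
proof -
  define th where "th = pi / real k"
  have kth: "real k * th = pi" unfolding th_def using assms by simp
  have sth: "sin th > 0" unfolding th_def using assms by (intro sin_gt_zero) (auto simp: field_simps)
  have e1: "(1 - 2 * real k) * th = th - 2 * pi" and e2: "(2 * real k) * th = 2 * pi"
    and e3: "(- 2 * real k) * th = - (2 * pi)" and e4: "(2 * real k + 1) * th = th + 2 * pi"
    using kth by (simp_all add: algebra_simps)
  have i1: "(form_pair_step (cos th) ^^ k) (sin th, 0) = (sin th, 0)"
    unfolding form_pair_step_iterate_1 e1 e2 by (simp add: sin_diff)
  have i2: "(form_pair_step (cos th) ^^ k) (0, sin th) = (0, sin th)"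
    unfolding form_pair_step_iterate_2 e3 e4 by (simp add: sin_add)
  obtain x y where z: "z = (x, y)" by force
  have "z = ((x / sin th) * sin th + (y / sin th) * 0, (x / sin th) * 0 + (y / sin th) * sin th)"
    using sth z by simp
  then have "(form_pair_step (cos th) ^^ k) z =
      ((x / sin th) * sin th + (y / sin th) * 0, (x / sin th) * 0 + (y / sin th) * sin th)"
    by (metis form_pair_step_linear i1 i2 fst_conv snd_conv)
  then show ?thesis using sth z th_def by simp
qed

text \<open>Coordinates of \<open>(\<sigma>\<^sub>c \<sigma>\<^sub>d)\<^sup>j e\<^sub>c\<close> in the basis \<open>e\<^sub>c, e\<^sub>d\<close> when \<open>B(e\<^sub>c, e\<^sub>d) = - c\<close>.\<close>

definition orbit_step :: "real \<Rightarrow> real \<times> real \<Rightarrow> real \<times> real" where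
  "orbit_step c z = (2 * c * (2 * c * fst z - snd z) - fst z, 2 * c * fst z - snd z)"

lemma orbit_step_iterate_1: "(orbit_step 1 ^^ j) (1, 0) = (2 * real j + 1, 2 * real j)"
  by (induction j) (auto simp: orbit_step_def algebra_simps)

lemma orbit_step_iterate_cos:
  assumes "sin th \<noteq> 0"
  shows "(orbit_step (cos th) ^^ j) (1, 0) =
    (sin ((2 * real j + 1) * th) / sin th, sin ((2 * real j) * th) / sin th)"
proof (induction j)
  case 0
  then show ?case using assms by simp
next
  case (Suc j)
  have rec: "2 * cos th * sin ((p + 1) * th) - sin (p * th) = sin ((p + 2) * th)" for p
    using sin_recurrence[of "- p" "p + 1" th] by (simp add: algebra_simps)
  have a: "2 * cos th * sin ((2 * real j + 1) * th) - sin ((2 * real j) * th) = sin ((2 * real j + 2) * th)"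
    using rec[of "2 * real j"] by (simp add: algebra_simps)
  have b: "2 * cos th * sin ((2 * real j + 2) * th) - sin ((2 * real j + 1) * th) = sin ((2 * real j + 3) * th)"
    using rec[of "2 * real j + 1"] by (simp add: algebra_simps)
  have "2 * cos th * (sin ((2 * real j + 1) * th) / sin th) - sin ((2 * real j) * th) / sin th
      = sin ((2 * real j + 2) * th) / sin th"
    using a by (metis diff_divide_distrib times_divide_eq_right)
  moreover have "2 * cos th * (sin ((2 * real j + 2) * th) / sin th) - sin ((2 * real j + 1) * th) / sin th
      = sin ((2 * real j + 3) * th) / sin th"
    using b by (metis diff_divide_distrib times_divide_eq_right)
  moreover have "2 * real (Suc j) + 1 = 2 * real j + 3" "2 * real (Suc j) = 2 * real j + 2"
    by simp_all
  ultimately show ?case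
    using Suc by (simp only: funpow.simps o_apply orbit_step_def fst_conv snd_conv)
qed

context coxeter_system
begin

text \<open>Vectors of \<open>\<real>\<^sup>S\<close> are functions \<open>S \<Rightarrow> real\<close>; the Tits form is
  \<open>B(e\<^sub>u, e\<^sub>v) = - cos (\<pi> / m\<^sub>u\<^sub>v)\<close>, which is \<open>-1\<close> for \<open>m\<^sub>u\<^sub>v = \<infinity>\<close>.\<close>

definition tits_form :: "'a \<Rightarrow> 'a \<Rightarrow> real" where
  "tits_form u v = (case m u v of enat k \<Rightarrow> - cos (pi / real k) | \<infinity> \<Rightarrow> -1)"

definition basis_vec :: "'a \<Rightarrow> 'a \<Rightarrow> real" where
  "basis_vec u x = (if x = u then 1 else 0)"

definition tits_form_basis :: "'a \<Rightarrow> ('a \<Rightarrow> real) \<Rightarrow> real" where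
  "tits_form_basis u f = (\<Sum>w\<in>S. tits_form u w * f w)"

definition reflect :: "'a \<Rightarrow> ('a \<Rightarrow> real) \<Rightarrow> 'a \<Rightarrow> real" where
  "reflect u f = (\<lambda>x. f x + (- 2 * tits_form_basis u f) * basis_vec u x)"

definition word_action :: "'a list \<Rightarrow> ('a \<Rightarrow> real) \<Rightarrow> 'a \<Rightarrow> real" where
  "word_action w = foldr reflect w"

lemma word_action_simps [simp]:
  "word_action [] f = f" "word_action (a # w) f = reflect a (word_action w f)"
  unfolding word_action_def by simp_all

lemma word_action_append: "word_action (u @ v) f = word_action u (word_action v f)"
  unfolding word_action_def by simp

lemma tits_form_diag: "u \<in> S \<Longrightarrow> tits_form u u = 1"
  unfolding tits_form_def using m_diag by (simp add: one_enat_def)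

lemma tits_form_sym: "u \<in> S \<Longrightarrow> v \<in> S \<Longrightarrow> tits_form u v = tits_form v u"
  unfolding tits_form_def using m_sym by simp

lemma tits_form_basis_add:
  assumes "v \<in> S"
  shows "tits_form_basis u (\<lambda>x. f x + a * basis_vec v x) = tits_form_basis u f + a * tits_form u v"
proof -
  have "tits_form_basis u (\<lambda>x. f x + a * basis_vec v x)
      = tits_form_basis u f + a * (\<Sum>w\<in>S. tits_form u w * basis_vec v w)"
    unfolding tits_form_basis_def by (simp add: algebra_simps sum.distrib sum_distrib_left)
  also have "(\<Sum>w\<in>S. tits_form u w * basis_vec v w) = tits_form u v"
    unfolding basis_vec_def using assms finite_S by (simp add: if_distrib cong: if_cong)
  finally show ?thesis .
qed

lemma tits_form_basis_combination:
  assumes "c \<in> S" "d \<in> S"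
  shows "tits_form_basis u (\<lambda>x. a * basis_vec c x + b * basis_vec d x) = a * tits_form u c + b * tits_form u d"
  using tits_form_basis_add[OF assms(2), of u "\<lambda>x. 0 + a * basis_vec c x"]
    tits_form_basis_add[OF assms(1), of u "\<lambda>x. 0"]
  by (simp add: tits_form_basis_def)

lemma tits_form_basis_reflect:
  "u \<in> S \<Longrightarrow> tits_form_basis v (reflect u f) = tits_form_basis v f - 2 * tits_form_basis u f * tits_form v u"
  unfolding reflect_def by (subst tits_form_basis_add) auto

lemma reflect_reflect: "u \<in> S \<Longrightarrow> reflect u (reflect u f) = f"
  unfolding reflect_def[of u "reflect u f"] tits_form_basis_reflect
  by (simp add: tits_form_diag reflect_def algebra_simps)

lemma word_action_in_span:
  assumes "s \<in> S" "t \<in> S" "w \<in> lists {s, t}"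
  shows "\<exists>\<alpha> \<beta>. word_action w f = (\<lambda>x. f x + \<alpha> * basis_vec s x + \<beta> * basis_vec t x)"
  using assms(3)
proof (induction w)
  case Nil
  show ?case by (rule exI[of _ 0], rule exI[of _ 0]) simp
next
  case (Cons a w)
  then obtain \<alpha> \<beta> where ab: "word_action w f = (\<lambda>x. f x + \<alpha> * basis_vec s x + \<beta> * basis_vec t x)"
    by auto
  let ?\<gamma> = "2 * tits_form_basis a (word_action w f)"
  have "a = s \<or> a = t" using Cons by auto
  then show ?case
  proof
    assume "a = s"
    then show ?thesis
      by (intro exI[of _ "\<alpha> - ?\<gamma>"] exI[of _ \<beta>]) (auto simp: reflect_def ab algebra_simps)
  next
    assume "a = t"
    then show ?thesis
      by (intro exI[of _ \<alpha>] exI[of _ "\<beta> - ?\<gamma>"]) (auto simp: reflect_def ab algebra_simps)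
  qed
qed

lemma form_pair_word_action_alt:
  assumes "s \<in> S" "t \<in> S"
  shows "(tits_form_basis s (word_action (alt s t (2 * j)) g), tits_form_basis t (word_action (alt s t (2 * j)) g))
    = (form_pair_step (- tits_form s t) ^^ j) (tits_form_basis s g, tits_form_basis t g)"
proof (induction j arbitrary: g)
  case (Suc j)
  have "word_action (alt s t (2 * Suc j)) g = word_action (alt s t (2 * j)) (reflect s (reflect t g))"
    unfolding alt_Suc_double word_action_append by simp
  moreover have "(tits_form_basis s (reflect s (reflect t g)), tits_form_basis t (reflect s (reflect t g)))
      = form_pair_step (- tits_form s t) (tits_form_basis s g, tits_form_basis t g)"
    unfolding form_pair_step_def using assms tits_form_sym[OF assms]
    by (simp add: tits_form_basis_reflect tits_form_diag algebra_simps)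
  ultimately show ?case using Suc by (simp add: funpow_swap1)
qed simp

text \<open>The relation \<open>(st)\<^sup>k = 1\<close> holds in the representation: \<open>(\<sigma>\<^sub>s \<sigma>\<^sub>t)\<^sup>k\<close> moves \<open>f\<close> only
  within the span of \<open>e\<^sub>s, e\<^sub>t\<close>, fixes the pair \<open>(B(e\<^sub>s, f), B(e\<^sub>t, f))\<close>, and on that span
  \<open>B\<close> is positive definite since \<open>0 \<le> cos (\<pi>/k) < 1\<close>.\<close>

lemma word_action_alt_relation:
  assumes st: "s \<in> S" "t \<in> S" "s \<noteq> t" and mk: "m s t = enat k"
  shows "word_action (alt s t (2 * k)) f = f"
proof -
  have k: "k \<ge> 2" using m_enat_ge_2[OF st mk] .
  define c where "c = cos (pi / real k)"
  have Bst: "tits_form s t = - c" "tits_form t s = - c"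
    unfolding tits_form_def c_def using mk m_sym[OF st(1,2)] by simp_all
  have Bss: "tits_form s s = 1" "tits_form t t = 1" using tits_form_diag st by auto
  have iter: "(tits_form_basis s (word_action (alt s t (2 * j)) g), tits_form_basis t (word_action (alt s t (2 * j)) g))
      = (form_pair_step c ^^ j) (tits_form_basis s g, tits_form_basis t g)" for j g
    using form_pair_word_action_alt[OF st(1,2)] Bst(1) by simp
  obtain \<alpha> \<beta> where ab: "word_action (alt s t (2 * k)) f = (\<lambda>x. f x + \<alpha> * basis_vec s x + \<beta> * basis_vec t x)"
    using word_action_in_span[OF st(1,2)] set_alt[of s t "2 * k"] by blast
  have "(form_pair_step c ^^ k) (tits_form_basis s f, tits_form_basis t f) = (tits_form_basis s f, tits_form_basis t f)"
    unfolding c_def using form_pair_step_period k by blast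
  then have "tits_form_basis s (word_action (alt s t (2 * k)) f) = tits_form_basis s f"
    "tits_form_basis t (word_action (alt s t (2 * k)) f) = tits_form_basis t f"
    using iter[of k f] by simp_all
  moreover have "tits_form_basis s (\<lambda>x. f x + \<alpha> * basis_vec s x + \<beta> * basis_vec t x)
      = tits_form_basis s f + \<alpha> - c * \<beta>"
    using tits_form_basis_add[OF st(2), of s "\<lambda>x. f x + \<alpha> * basis_vec s x"]
      tits_form_basis_add[OF st(1), of s f] Bst Bss by simp
  moreover have "tits_form_basis t (\<lambda>x. f x + \<alpha> * basis_vec s x + \<beta> * basis_vec t x)
      = tits_form_basis t f - c * \<alpha> + \<beta>"
    using tits_form_basis_add[OF st(2), of t "\<lambda>x. f x + \<alpha> * basis_vec s x"]
      tits_form_basis_add[OF st(1), of t f] Bst Bss by simp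
  ultimately have e1: "\<alpha> = c * \<beta>" and e2: "\<beta> = c * \<alpha>"
    unfolding ab by simp_all
  have c0: "0 \<le> c" and c1: "c < 1" unfolding c_def using cos_pi_div_bounds[OF k] by simp_all
  have "c * c \<le> c * 1" using c0 c1 by (intro mult_left_mono) auto
  then have "c * c < 1" using c1 by simp
  moreover have "\<alpha> * (1 - c * c) = 0" using e1 e2 by (simp add: algebra_simps)
  ultimately have "\<alpha> = 0" by simp
  with e2 ab show ?thesis by simp
qed

lemma word_action_ceq: "ceq u w \<Longrightarrow> word_action u = word_action w"
proof (induction rule: coxeter_eq.induct)
  case (rel s t k u v)
  have "word_action (alt s t (2 * k)) f = f" for f
  proof (cases "s = t")
    case True
    then have "k = 1" using rel m_diag by (simp add: one_enat_def)
    then show ?thesis using True reflect_reflect rel by (simp add: numeral_2_eq_2)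
  qed (use word_action_alt_relation rel in blast)
  then show ?case by (intro ext) (simp add: word_action_append)
qed auto

lemma word_action_alt_basis_vec:
  assumes cd: "c \<in> S" "d \<in> S" "c \<noteq> d"
  shows "word_action (alt c d (2 * j)) (basis_vec c) =
    (\<lambda>x. fst ((orbit_step (- tits_form c d) ^^ j) (1, 0)) * basis_vec c x
       + snd ((orbit_step (- tits_form c d) ^^ j) (1, 0)) * basis_vec d x)"
proof (induction j)
  case 0
  show ?case by (rule ext) (simp add: basis_vec_def)
next
  case (Suc j)
  define c0 where "c0 = - tits_form c d"
  obtain a b where ab: "(orbit_step c0 ^^ j) (1, 0) = (a, b)" by force
  have B: "tits_form c d = - c0" "tits_form d c = - c0" "tits_form c c = 1" "tits_form d d = 1"
    unfolding c0_def using tits_form_sym tits_form_diag cd by auto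
  have "word_action (alt c d (2 * Suc j)) (basis_vec c)
      = reflect c (reflect d (\<lambda>x. a * basis_vec c x + b * basis_vec d x))"
    using Suc ab unfolding c0_def by (simp add: word_action_append)
  also have "reflect d (\<lambda>x. a * basis_vec c x + b * basis_vec d x)
      = (\<lambda>x. a * basis_vec c x + (2 * c0 * a - b) * basis_vec d x)"
    unfolding reflect_def tits_form_basis_combination[OF cd(1,2)] B
    by (rule ext) (simp add: algebra_simps)
  also have "reflect c (\<lambda>x. a * basis_vec c x + (2 * c0 * a - b) * basis_vec d x)
      = (\<lambda>x. (2 * c0 * (2 * c0 * a - b) - a) * basis_vec c x + (2 * c0 * a - b) * basis_vec d x)"
    unfolding reflect_def tits_form_basis_combination[OF cd(1,2)] B
    by (rule ext) (simp add: algebra_simps basis_vec_def)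
  finally have "word_action (alt c d (2 * Suc j)) (basis_vec c)
      = (\<lambda>x. (2 * c0 * (2 * c0 * a - b) - a) * basis_vec c x + (2 * c0 * a - b) * basis_vec d x)" .
  moreover have "(orbit_step c0 ^^ Suc j) (1, 0) = (2 * c0 * (2 * c0 * a - b) - a, 2 * c0 * a - b)"
    using ab by (simp add: orbit_step_def)
  ultimately show ?case unfolding c0_def by simp
qed

lemma orbit_step_iterate_ne:
  assumes "1 \<le> k"
  shows "(orbit_step 1 ^^ k) (1, 0) \<noteq> (1, 0)"
    and "k < M \<Longrightarrow> (orbit_step (cos (pi / real M)) ^^ k) (1, 0) \<noteq> (1, 0)"
proof -
  show "(orbit_step 1 ^^ k) (1, 0) \<noteq> (1, 0)" using assms orbit_step_iterate_1[of k] by simp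
  assume Mk: "k < M"
  define th where "th = pi / real M"
  have th: "0 < th" "real M * th = pi" unfolding th_def using Mk by simp_all
  have "th < pi" unfolding th_def using Mk assms by (simp add: field_simps)
  then have sth: "sin th > 0" using th by (intro sin_gt_zero) auto
  have "real k * th < real M * th" using Mk th(1) by simp
  then have range: "- pi < (2 * real k) * th - pi" "(2 * real k) * th - pi < pi"
    using th assms by simp_all
  show "(orbit_step (cos th) ^^ k) (1, 0) \<noteq> (1, 0)"
  proof
    assume fixed: "(orbit_step (cos th) ^^ k) (1, 0) = (1, 0)"
    then have "sin ((2 * real k) * th) = 0"
      using orbit_step_iterate_cos[of th k] sth by simp
    then have "sin ((2 * real k) * th - pi) = 0" by (simp add: sin_diff)
    then have "(2 * real k + 1) * th = pi + th"
      using sin_eq_0_pi[OF range] by (simp add: algebra_simps)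
    then show False
      using fixed orbit_step_iterate_cos[of th k] sth by (simp add: sin_add)
  qed
qed

lemma m_le_if_alt_trivial:
  assumes cd: "c \<in> S" "d \<in> S" "c \<noteq> d" and k: "k \<ge> 1"
    and triv: "ceq (alt c d (2 * k)) []"
  shows "\<exists>M. m c d = enat M \<and> M \<le> k"
proof -
  let ?v = "(orbit_step (- tits_form c d) ^^ k) (1, 0)"
  have "word_action (alt c d (2 * k)) (basis_vec c) = basis_vec c"
    using word_action_ceq[OF triv] by simp
  then have h: "(\<lambda>x. fst ?v * basis_vec c x + snd ?v * basis_vec d x) = basis_vec c"
    using word_action_alt_basis_vec[OF cd] by simp
  have v: "?v = (1, 0)"
    using fun_cong[OF h, of c] fun_cong[OF h, of d] cd by (simp add: basis_vec_def prod_eq_iff)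
  show ?thesis
  proof (cases "m c d")
    case infinity
    then show ?thesis using v orbit_step_iterate_ne(1)[OF k] by (simp add: tits_form_def)
  next
    case (enat M)
    then show ?thesis
      using v orbit_step_iterate_ne(2)[OF k, of M] by (cases "M \<le> k") (auto simp: tits_form_def)
  qed
qed

end

section \<open>Two left descents\<close>

context coxeter_system
begin

definition parabolic_split :: "'a \<Rightarrow> 'a \<Rightarrow> 'a list \<Rightarrow> 'a list \<Rightarrow> 'a list \<Rightarrow> bool" where
  "parabolic_split s t x a z \<longleftrightarrow> a \<in> lists {s, t} \<and> ceq x (a @ z)
     \<and> (\<forall>a' z'. a' \<in> lists {s, t} \<longrightarrow> ceq x (a' @ z') \<longrightarrow> length z \<le> length z')
     \<and> (\<forall>a'. a' \<in> lists {s, t} \<longrightarrow> ceq x (a' @ z) \<longrightarrow> length a \<le> length a')"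

lemma parabolic_split_exists:
  assumes "x \<in> lists S"
  shows "\<exists>a z. parabolic_split s t x a z"
proof -
  let ?C = "{z. \<exists>a \<in> lists {s, t}. ceq x (a @ z)}"
  have "x \<in> ?C" using ceq_refl[OF assms] by (intro CollectI bexI[of _ "[]"]) auto
  then obtain z where "z \<in> ?C" and z_min: "\<And>z'. z' \<in> ?C \<Longrightarrow> length z \<le> length z'"
    using ex_has_least_nat[of "\<lambda>z. z \<in> ?C" x length] by blast
  let ?A = "{a \<in> lists {s, t}. ceq x (a @ z)}"
  obtain a1 where "a1 \<in> ?A" using \<open>z \<in> ?C\<close> by blast
  then obtain a where "a \<in> ?A" and "\<And>a'. a' \<in> ?A \<Longrightarrow> length a \<le> length a'"
    using ex_has_least_nat[of "\<lambda>a. a \<in> ?A" a1 length] by blast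
  then have "parabolic_split s t x a z"
    unfolding parabolic_split_def using z_min by blast
  then show ?thesis by blast
qed

lemma parabolic_split_in_lists:
  assumes "parabolic_split s t x a z"
  shows "a \<in> lists S \<and> z \<in> lists S"
proof -
  have "ceq x (a @ z)" using assms unfolding parabolic_split_def by blast
  then have "a @ z \<in> lists S" using ceq_in_lists by blast
  then show ?thesis by simp
qed

lemma parabolic_split_reduced:
  assumes split: "parabolic_split s t x a z"
  shows "reduced S m (a @ z)"
proof (rule reduced_if_refl_words_distinct)
  have a: "a \<in> lists {s, t}" and x: "ceq x (a @ z)"
    and z_min: "\<And>a' z'. a' \<in> lists {s, t} \<Longrightarrow> ceq x (a' @ z') \<Longrightarrow> length z \<le> length z'"
    and a_min: "\<And>a'. a' \<in> lists {s, t} \<Longrightarrow> ceq x (a' @ z) \<Longrightarrow> length a \<le> length a'"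
    using split unfolding parabolic_split_def by blast+
  show az: "a @ z \<in> lists S" using parabolic_split_in_lists[OF split] by simp
  fix i j assume ij: "i < j" "j < length (a @ z)"
  show "\<not> ceq (refl_word (a @ z) i) (refl_word (a @ z) j)"
  proof
    assume "ceq (refl_word (a @ z) i) (refl_word (a @ z) j)"
    then have x': "ceq x (del_nth (del_nth (a @ z) j) i)"
      using ceq_trans[OF x deletion_condition[OF az ij]] by simp
    consider "j < length a" | "i < length a" "length a \<le> j" | "length a \<le> i"
      using ij by linarith
    then show False
    proof cases
      case 1
      have "del_nth (del_nth (a @ z) j) i = del_nth (del_nth a j) i @ z"
        using 1 ij length_del_nth[of j a] by (simp add: del_nth_append less_diff_conv)
      then have "ceq x (del_nth (del_nth a j) i @ z)" using x' by simp
      then have "length a \<le> length (del_nth (del_nth a j) i)"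
        using a_min del_nth_in_lists[OF del_nth_in_lists[OF a]] by blast
      then show False using 1 ij length_del_nth[of j a] length_del_nth[of i "del_nth a j"] by simp
    next
      case 2
      have "del_nth (del_nth (a @ z) j) i = del_nth a i @ del_nth z (j - length a)"
        using 2 by (simp add: del_nth_append)
      then have "ceq x (del_nth a i @ del_nth z (j - length a))" using x' by simp
      then have "length z \<le> length (del_nth z (j - length a))"
        using z_min del_nth_in_lists[OF a] by blast
      then show False using 2 ij length_del_nth[of "j - length a" z] by simp
    next
      case 3
      let ?z' = "del_nth (del_nth z (j - length a)) (i - length a)"
      have "del_nth (del_nth (a @ z) j) i = a @ ?z'"
        using 3 ij by (simp add: del_nth_append)
      then have "ceq x (a @ ?z')" using x' by simp
      then have "length z \<le> length ?z'" using z_min a by blast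
      then show False
        using 3 ij length_del_nth[of "j - length a" z] length_del_nth[of "i - length a" "del_nth z (j - length a)"]
        by simp
    qed
  qed
qed

lemma parabolic_split_descent:
  assumes x: "reduced S m x" and split: "parabolic_split s t x a z" and r: "r \<in> {s, t}"
    and desc: "i < length x" "ceq (refl_word x i) [r]"
  shows "\<exists>i'<length a. ceq (refl_word a i') [r]"
proof -
  have xaz: "ceq x (a @ z)" and a: "a \<in> lists {s, t}"
    and z_min: "\<And>a' z'. a' \<in> lists {s, t} \<Longrightarrow> ceq x (a' @ z') \<Longrightarrow> length z \<le> length z'"
    using split unfolding parabolic_split_def by blast+
  have l: "a \<in> lists S" "z \<in> lists S" using parabolic_split_in_lists[OF split] by auto
  obtain j where j: "j < length (a @ z)" "ceq (refl_word (a @ z) j) [r]"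
    using reduced_refl_word_transfer[OF x xaz desc] by blast
  show ?thesis
  proof (cases "j < length a")
    case True
    then show ?thesis using j refl_word_append_left[OF True, of z] by auto
  next
    case False
    text \<open>Otherwise \<open>r\<close> could be moved from \<open>z\<close> into \<open>a\<close>, shortening \<open>z\<close>.\<close>
    define k where "k = j - length a"
    have k: "j = length a + k" "k < length z" using False j unfolding k_def by auto
    have "ceq (a @ refl_word z k @ rev a) [r]" using j refl_word_append_right[of a z k] k by simp
    then have tz: "ceq (refl_word z k) (rev a @ [r] @ a)" by (rule ceq_conj_iff[OF l(1), THEN iffD1])
    have "ceq z (refl_word z k @ del_nth z k)" using ceq_refl_word_del_nth l k by blast
    moreover have "ceq (refl_word z k @ del_nth z k) ((rev a @ [r] @ a) @ del_nth z k)"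
      using ceq_cong_right[OF tz del_nth_in_lists] l by blast
    ultimately have "ceq (a @ z) (a @ (rev a @ [r] @ a) @ del_nth z k)"
      using ceq_cong_left[OF ceq_trans l(1)] by blast
    then have "ceq x ((a @ rev a @ [r] @ a) @ del_nth z k)"
      using ceq_trans[OF xaz] by simp
    moreover have "a @ rev a @ [r] @ a \<in> lists {s, t}" using a r by auto
    ultimately have "length z \<le> length (del_nth z k)" using z_min by blast
    then show ?thesis using length_del_nth[of k z] k by simp
  qed
qed

lemma parabolic_split_alternating:
  assumes "s \<noteq> t" and split: "parabolic_split s t x a z"
  shows "a = alt s t (length a) \<or> a = alt t s (length a)"
proof (rule alt_if_no_square[OF assms(1)])
  have xaz: "ceq x (a @ z)" and a: "a \<in> lists {s, t}"
    and a_min: "\<And>a'. a' \<in> lists {s, t} \<Longrightarrow> ceq x (a' @ z) \<Longrightarrow> length a \<le> length a'"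
    using split unfolding parabolic_split_def by blast+
  show "a \<in> lists {s, t}" by (fact a)
  show "\<forall>p q y. a \<noteq> p @ [y, y] @ q"
  proof (intro allI notI)
    fix p q y assume a_eq: "a = p @ [y, y] @ q"
    have "y \<in> S" "p \<in> lists S" "q @ z \<in> lists S"
      using parabolic_split_in_lists[OF split] a_eq by auto
    then have "ceq (p @ [y, y] @ q @ z) (p @ q @ z)"
      by (rule ceq_delete_square[rotated 2])
    then have "ceq x ((p @ q) @ z)"
      using ceq_trans[OF xaz] a_eq by simp
    moreover have "p @ q \<in> lists {s, t}" using a a_eq by auto
    ultimately have "length a \<le> length (p @ q)" using a_min by blast
    then show False using a_eq by simp
  qed
qed

lemma m_le_if_alt_refl_word:
  assumes "c \<in> S" "d \<in> S" "c \<noteq> d" "j < n" "ceq (refl_word (alt c d n) j) [d]"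
  shows "\<exists>M. m c d = enat M \<and> M \<le> Suc j"
proof -
  have r: "refl_word (alt c d n) j = alt c d (2 * j + 1)" by (rule refl_word_alt[OF assms(4)])
  have "ceq (alt c d (2 * Suc j)) ([d] @ [d])"
    using ceq_cong_right[OF assms(5), of "[d]"] assms(2) unfolding r alt_odd_snoc by simp
  then have "ceq (alt c d (2 * Suc j)) []"
    using ceq_trans ceq_square[OF assms(2)] by fastforce
  then show ?thesis using m_le_if_alt_trivial[OF assms(1-3)] by simp
qed

lemma parabolic_split_length_le_m:
  assumes split: "parabolic_split s t x (alt c d n) z" and cd: "c \<in> S" "d \<in> S" "{c, d} = {s, t}"
    and M: "m c d = enat M"
  shows "n \<le> M"
proof (rule ccontr)
  assume "\<not> n \<le> M"
  then have n: "n = Suc M + (n - Suc M)" by simp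
  define rest where "rest = (if even (Suc M) then alt c d (n - Suc M) else alt d c (n - Suc M))"
  have a: "alt c d n = alt c d (Suc M) @ rest"
    unfolding rest_def by (subst n) (rule alt_add)
  have xaz: "ceq x (alt c d n @ z)"
    and a_min: "\<And>a'. a' \<in> lists {s, t} \<Longrightarrow> ceq x (a' @ z) \<Longrightarrow> length (alt c d n) \<le> length a'"
    using split unfolding parabolic_split_def by blast+
  have l: "c \<in> S" "d \<in> S" "rest @ z \<in> lists S"
    using parabolic_split_in_lists[OF split] a cd by auto
  have "ceq (alt c d (Suc M) @ rest @ z) (alt d c (M - 1) @ rest @ z)"
    using ceq_cong_right[OF ceq_alt_Suc[OF l(1,2) M] l(3)] by simp
  then have "ceq x ((alt d c (M - 1) @ rest) @ z)" using xaz a ceq_trans by simp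
  moreover have "alt d c (M - 1) @ rest \<in> lists {s, t}"
  proof -
    have "set (alt c d k) \<subseteq> {s, t}" "set (alt d c k) \<subseteq> {s, t}" for k
      using set_alt[of c d k] set_alt[of d c k] cd(3) by (auto simp: insert_commute)
    then show ?thesis unfolding rest_def by (auto simp del: set_alt)
  qed
  ultimately have "length (alt c d n) \<le> length (alt d c (M - 1) @ rest)" by (rule a_min[rotated])
  moreover have "length rest = n - Suc M" unfolding rest_def by simp
  ultimately show False using n by simp
qed

text \<open>\<open>ceq (refl_word x i) [s]\<close> says that \<open>s\<close> is a left descent of \<open>x\<close>.\<close>

lemma two_left_descents:
  assumes x: "reduced S m x" and st: "s \<in> S" "t \<in> S" "s \<noteq> t"
    and ds: "i < length x" "ceq (refl_word x i) [s]"
    and dt: "j < length x" "ceq (refl_word x j) [t]"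
  shows "\<exists>M z. m s t = enat M \<and> ceq x (alt s t M @ z) \<and> M + length z = length x"
proof -
  obtain a z where split: "parabolic_split s t x a z"
    using parabolic_split_exists reduced_in_lists[OF x] by blast
  have xaz: "ceq x (a @ z)" using split unfolding parabolic_split_def by blast
  have len: "length a + length z = length x"
    using reduced_length_eq[OF x parabolic_split_reduced[OF split] xaz] by simp
  obtain c d where cd: "(c = s \<and> d = t) \<or> (c = t \<and> d = s)" and a: "a = alt c d (length a)"
    using parabolic_split_alternating[OF st(3) split] by blast
  have cdS: "c \<in> S" "d \<in> S" "c \<noteq> d" "{c, d} = {s, t}" using cd st by auto
  have "d \<in> {s, t}" using cd by auto
  then obtain j' where j': "j' < length a" "ceq (refl_word a j') [d]"
    using parabolic_split_descent[OF x split] ds dt by blast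
  then obtain M where M: "m c d = enat M" "M \<le> Suc j'"
    using m_le_if_alt_refl_word[OF cdS(1-3), of j' "length a"] a by auto
  have "length a \<le> M"
    using parabolic_split_length_le_m[OF _ cdS(1,2,4) M(1)] split a by simp
  then have "length a = M" using M j' by simp
  then have aM: "a = alt c d M" using a by simp
  show ?thesis
  proof (cases "c = s")
    case True
    then show ?thesis using cd M aM len xaz by auto
  next
    case False
    then have cs: "c = t" "d = s" using cd by auto
    have "ceq (alt t s M @ z) (alt s t M @ z)"
      using ceq_cong_right[OF ceq_braid[of t s M]] st M cs parabolic_split_in_lists[OF split] by simp
    moreover have "m s t = enat M" using M cs m_sym st by simp
    ultimately show ?thesis
      using xaz aM cs len ceq_trans by auto
  qed
qed

end

section \<open>Matsumoto's theorem\<close>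

context coxeter_system
begin

definition braid_step :: "'a list \<Rightarrow> 'a list \<Rightarrow> bool" where
  "braid_step x y \<longleftrightarrow> (\<exists>p q s t M. s \<in> S \<and> t \<in> S \<and> s \<noteq> t \<and> m s t = enat M \<and>
     p \<in> lists S \<and> q \<in> lists S \<and> x = p @ alt s t M @ q \<and> y = p @ alt t s M @ q)"

definition braid_eq :: "'a list \<Rightarrow> 'a list \<Rightarrow> bool" where
  "braid_eq = braid_step\<^sup>*\<^sup>*"

lemma braid_eq_refl [simp]: "braid_eq x x"
  unfolding braid_eq_def by simp

lemma braid_eq_trans: "braid_eq x y \<Longrightarrow> braid_eq y z \<Longrightarrow> braid_eq x z"
  unfolding braid_eq_def by simp

lemma braid_step_cong:
  assumes "braid_step x y" "u \<in> lists S" "v \<in> lists S"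
  shows "braid_step (u @ x @ v) (u @ y @ v)"
proof -
  obtain p q s t M where "s \<in> S" "t \<in> S" "s \<noteq> t" "m s t = enat M" "p \<in> lists S" "q \<in> lists S"
    "x = p @ alt s t M @ q" "y = p @ alt t s M @ q"
    using assms(1) unfolding braid_step_def by blast
  then show ?thesis
    unfolding braid_step_def using assms(2,3)
    by (intro exI[of _ "u @ p"] exI[of _ "q @ v"] exI[of _ s] exI[of _ t] exI[of _ M]) auto
qed

lemma braid_eq_cong: "braid_eq x y \<Longrightarrow> u \<in> lists S \<Longrightarrow> v \<in> lists S \<Longrightarrow> braid_eq (u @ x @ v) (u @ y @ v)"
  unfolding braid_eq_def
  by (induction rule: rtranclp_induct) (auto intro: braid_step_cong rtranclp.rtrancl_into_rtrancl)

lemma ceq_if_braid_eq: "braid_eq x y \<Longrightarrow> x \<in> lists S \<Longrightarrow> ceq x y"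
  unfolding braid_eq_def
proof (induction rule: rtranclp_induct)
  case (step y z)
  have "ceq y z" using step(2) unfolding braid_step_def using ceq_cong ceq_braid by fastforce
  then show ?case using step ceq_trans by blast
qed (simp add: ceq_refl)

text \<open>Both \<open>s\<close> and \<open>t\<close> are left descents, so by \<open>two_left_descents\<close> the element also has
  the reduced expressions \<open>s t s \<dots> z\<close> and \<open>t s t \<dots> z\<close>, which are related by one braid move.\<close>

lemma braid_bridge:
  assumes u: "reduced S m (s # u)" and w: "reduced S m (t # w)" and uw: "ceq (s # u) (t # w)"
    and "s \<noteq> t"
  shows "\<exists>v1 v2. reduced S m (s # v1) \<and> reduced S m (t # v2) \<and> braid_eq (s # v1) (t # v2)
    \<and> ceq (s # u) (s # v1) \<and> ceq (t # v2) (t # w) \<and> length v1 = length u \<and> length v2 = length u"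
proof -
  have st: "s \<in> S" "t \<in> S" using reduced_in_lists[OF u] reduced_in_lists[OF w] by auto
  have "ceq (refl_word (s # u) 0) [s]" "ceq (refl_word (t # w) 0) [t]"
    using st by (simp_all add: refl_word_Cons_0 ceq_refl)
  moreover obtain j where "j < length (s # u)" "ceq (refl_word (s # u) j) [t]"
    using reduced_refl_word_transfer[OF w ceq_sym[OF uw], of 0] \<open>ceq (refl_word (t # w) 0) [t]\<close> by auto
  ultimately obtain M z where Mz: "m s t = enat M" "ceq (s # u) (alt s t M @ z)" "M + length z = Suc (length u)"
    using two_left_descents[OF u st \<open>s \<noteq> t\<close>] by fastforce
  have M: "M \<ge> 2" using m_enat_ge_2[OF st \<open>s \<noteq> t\<close> Mz(1)] .
  have zl: "z \<in> lists S" using ceq_in_lists[OF Mz(2)] by auto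
  have v12: "ceq (alt s t M @ z) (alt t s M @ z)"
    using ceq_cong_right[OF ceq_braid[OF st Mz(1)] zl] .
  have r1: "reduced S m (alt s t M @ z)" using reduced_ceq_same_length[OF u Mz(2)] Mz(3) by simp
  have r2: "reduced S m (alt t s M @ z)" using reduced_ceq_same_length[OF r1 v12] by simp
  have "braid_eq (alt s t M @ z) (alt t s M @ z)"
    unfolding braid_eq_def braid_step_def
    using st \<open>s \<noteq> t\<close> Mz(1) zl by (intro r_into_rtranclp exI[of _ "[]"] exI[of _ z]) auto
  moreover have "ceq (alt t s M @ z) (t # w)"
    using ceq_trans[OF ceq_sym[OF v12] ceq_trans[OF ceq_sym[OF Mz(2)] uw]] .
  moreover obtain M' where "M = Suc M'" using M by (cases M) auto
  ultimately show ?thesis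
    using r1 r2 Mz(2,3) by (intro exI[of _ "alt t s M' @ z"] exI[of _ "alt s t M' @ z"]) simp
qed

theorem matsumoto: "reduced S m u \<Longrightarrow> reduced S m w \<Longrightarrow> ceq u w \<Longrightarrow> braid_eq u w"
proof (induction "length u" arbitrary: u w rule: less_induct)
  case less
  have same_head: "braid_eq (a # x) (a # y)"
    if "reduced S m (a # x)" "reduced S m (a # y)" "ceq (a # x) (a # y)" "length x < length u"
    for a x y
  proof -
    have a: "a \<in> S" using reduced_in_lists[OF that(1)] by simp
    have "ceq x y" using ceq_cancel_left[of "[a]" x y] that a by simp
    moreover have "reduced S m x" "reduced S m y"
      using reduced_appendD(2)[of "[a]"] that by auto
    ultimately have "braid_eq x y" using less.hyps[of x y] that by simp
    then show ?thesis using braid_eq_cong[of x y "[a]" "[]"] a by simp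
  qed
  show ?case
  proof (cases u)
    case Nil
    then show ?thesis using reduced_length_eq[OF less.prems] by simp
  next
    case (Cons s u')
    have "length w = length u" using reduced_length_eq less.prems by simp
    then obtain t w' where w: "w = t # w'" using Cons by (cases w) auto
    show ?thesis
    proof (cases "s = t")
      case True
      then show ?thesis using same_head less.prems Cons w by simp
    next
      case False
      then obtain v1 v2 where v: "reduced S m (s # v1)" "reduced S m (t # v2)" "braid_eq (s # v1) (t # v2)"
        "ceq (s # u') (s # v1)" "ceq (t # v2) (t # w')" "length v1 = length u'" "length v2 = length u'"
        using braid_bridge less.prems Cons w by blast
      then have "braid_eq u (s # v1)" "braid_eq (t # v2) w"
        using same_head[of s u' v1] same_head[of t v2 w'] less.prems Cons w by simp_all
      then show ?thesis using v(3) braid_eq_trans by blast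
    qed
  qed
qed

lemma exchange_condition_snoc:
  assumes P: "reduced S m P" and b: "b \<in> S" and nr: "\<not> reduced S m (P @ [b])"
  shows "\<exists>i<length P. ceq P (del_nth P i @ [b])"
proof -
  have Pl: "P \<in> lists S" using reduced_in_lists[OF P] .
  obtain i j where ij: "i < j" "j < length (P @ [b])"
    and e: "ceq (refl_word (P @ [b]) i) (refl_word (P @ [b]) j)"
    using reduced_if_refl_words_distinct[of "P @ [b]"] Pl b nr by auto
  have jP: "j = length P"
  proof (rule ccontr)
    assume "j \<noteq> length P"
    then have "j < length P" using ij by simp
    then show False
      using reduced_refl_words_distinct[OF P ij(1)] e refl_word_append_left ij(1) by (metis order.strict_trans)
  qed
  have "del_nth (del_nth (P @ [b]) j) i = del_nth P i" unfolding jP by (simp add: del_nth_def)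
  then have "ceq (P @ [b]) (del_nth P i)" using deletion_condition[OF _ ij e] Pl b by simp
  then have "ceq ((P @ [b]) @ [b]) (del_nth P i @ [b])"
    using ceq_cong_right[of "P @ [b]" "del_nth P i" "[b]"] b by simp
  moreover have "ceq (P @ [b, b] @ []) (P @ [])" using ceq_delete_square[of P "[]" b] Pl b by simp
  ultimately have "ceq P (del_nth P i @ [b])"
    by (metis append.assoc append_Cons append_Nil append_Nil2 ceq_sym ceq_trans)
  then show ?thesis using ij jP by auto
qed

lemma braid_eq_square_if_not_reduced:
  assumes w: "w \<in> lists S" and nr: "\<not> reduced S m w"
  shows "\<exists>p q b. b \<in> S \<and> braid_eq w (p @ [b, b] @ q)"
proof -
  obtain n where n: "\<not> reduced S m (take n w)"
    and n_min: "\<And>n'. \<not> reduced S m (take n' w) \<Longrightarrow> n \<le> n'"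
    using ex_has_least_nat[of "\<lambda>n. \<not> reduced S m (take n w)" "length w" id] nr by auto
  have "n \<noteq> 0" using n reduced_Nil by (cases n) auto
  moreover have "n \<le> length w" using n_min[of "length w"] nr by simp
  ultimately obtain P b rest where wd: "w = P @ [b] @ rest" and Pb: "take n w = P @ [b]"
    and Pn: "P = take (n - 1) w"
    by (metis Suc_pred' id_take_nth_drop le_eq_less_or_eq less_imp_diff_less not_gr_zero
        take_Suc_conv_app_nth take_all append_Cons append_Nil append_take_drop_id Suc_le_eq)
  have P: "reduced S m P" using n_min[of "n - 1"] Pn \<open>n \<noteq> 0\<close> by fastforce
  have l: "P \<in> lists S" "b \<in> S" "rest \<in> lists S" using w wd by auto
  obtain i where i: "i < length P" and cP: "ceq P (del_nth P i @ [b])"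
    using exchange_condition_snoc[OF P l(2)] n Pb by auto
  have "reduced S m (del_nth P i @ [b])"
    using reduced_ceq_same_length[OF P cP] length_del_nth[OF i] i by simp
  then have "braid_eq P (del_nth P i @ [b])" using matsumoto P cP by blast
  then have "braid_eq ([] @ P @ ([b] @ rest)) ([] @ (del_nth P i @ [b]) @ ([b] @ rest))"
    using l by (intro braid_eq_cong) auto
  then show ?thesis using wd l by (intro exI[of _ "del_nth P i"] exI[of _ rest] exI[of _ b]) auto
qed

end

section \<open>Fully commutative elements and forbidden factors\<close>

lemma comm_step_in_lists: "comm_step m x y \<Longrightarrow> x \<in> lists A \<Longrightarrow> y \<in> lists A"
  unfolding comm_step_def by auto

lemma comm_eq_in_lists: "comm_eq m x y \<Longrightarrow> x \<in> lists A \<Longrightarrow> y \<in> lists A"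
  unfolding comm_eq_def by (induction rule: rtranclp_induct) (auto simp: comm_step_in_lists)

lemma comm_eq_refl [simp]: "comm_eq m u u"
  unfolding comm_eq_def by simp

lemma comm_eq_trans: "comm_eq m x y \<Longrightarrow> comm_eq m y z \<Longrightarrow> comm_eq m x z"
  unfolding comm_eq_def by simp

lemma comm_eq_length: "comm_eq m x y \<Longrightarrow> length x = length y"
  unfolding comm_eq_def comm_step_def by (induction rule: rtranclp_induct) auto

lemma comm_step_cong: "comm_step m u v \<Longrightarrow> comm_step m (p @ u @ q) (p @ v @ q)"
  unfolding comm_step_def by (metis append.assoc)

lemma comm_eq_cong: "comm_eq m u v \<Longrightarrow> comm_eq m (p @ u @ q) (p @ v @ q)"
  unfolding comm_eq_def
  by (induction rule: rtranclp_induct) (auto intro: comm_step_cong rtranclp.rtrancl_into_rtrancl)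

lemma comm_eq_snoc: "comm_eq m u v \<Longrightarrow> comm_eq m (u @ [a]) (v @ [a])"
  using comm_eq_cong[of m u v "[]" "[a]"] by simp

lemma comm_eq_move_left: "\<forall>b\<in>set y. m b a = 2 \<Longrightarrow> comm_eq m (p @ y @ [a]) (p @ [a] @ y)"
proof (induction y arbitrary: p)
  case (Cons b y)
  have "comm_eq m ((p @ [b]) @ y @ [a]) ((p @ [b]) @ [a] @ y)"
    using Cons.IH[of "p @ [b]"] Cons.prems by simp
  moreover have "comm_step m (p @ [b, a] @ y) (p @ [a, b] @ y)"
    unfolding comm_step_def using Cons.prems by auto
  then have "comm_eq m (p @ [b, a] @ y) (p @ [a, b] @ y)"
    unfolding comm_eq_def by simp
  ultimately show ?case using comm_eq_trans by fastforce
qed simp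

lemma filter_pair_comm_eq:
  assumes "\<And>a b. a \<in> {s, t} \<Longrightarrow> b \<in> {s, t} \<Longrightarrow> m a b \<noteq> 2" and c: "comm_eq m x y"
  shows "filter (\<lambda>a. a \<in> {s, t}) x = filter (\<lambda>a. a \<in> {s, t}) y"
  using c unfolding comm_eq_def
proof (induction rule: rtranclp_induct)
  case (step y z)
  from step(2) obtain u v c d where h: "m c d = 2" "y = u @ [c, d] @ v" "z = u @ [d, c] @ v"
    unfolding comm_step_def by blast
  have "\<not> (c \<in> {s, t} \<and> d \<in> {s, t})"
    using h(1) assms(1) by blast
  then have "filter (\<lambda>a. a \<in> {s, t}) [c, d] = filter (\<lambda>a. a \<in> {s, t}) [d, c]" by auto
  then have "filter (\<lambda>a. a \<in> {s, t}) y = filter (\<lambda>a. a \<in> {s, t}) z"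
    unfolding h(2,3) by (simp only: filter_append)
  then show ?case using step.IH by simp
qed simp

context coxeter_system
begin

lemma comm_step_sym: "comm_step m x y \<Longrightarrow> x \<in> lists S \<Longrightarrow> comm_step m y x"
  unfolding comm_step_def by (auto dest: m_sym) (metis m_sym)

lemma comm_eq_sym: "comm_eq m x y \<Longrightarrow> x \<in> lists S \<Longrightarrow> comm_eq m y x"
  unfolding comm_eq_def
proof (induction rule: rtranclp_induct)
  case (step y z)
  have "y \<in> lists S" using comm_eq_in_lists step unfolding comm_eq_def by blast
  then have "comm_step m z y" using comm_step_sym step by blast
  then show ?case using step by (meson converse_rtranclp_into_rtranclp)
qed simp

lemma braid_eq_if_comm_eq: "comm_eq m x y \<Longrightarrow> x \<in> lists S \<Longrightarrow> braid_eq x y"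
  unfolding comm_eq_def
proof (induction rule: rtranclp_induct)
  case (step y z)
  obtain u v s t where h: "m s t = 2" "y = u @ [s, t] @ v" "z = u @ [t, s] @ v"
    using step(2) unfolding comm_step_def by blast
  have "y \<in> lists S" using comm_eq_in_lists step unfolding comm_eq_def by blast
  then have "u \<in> lists S" "v \<in> lists S" "s \<in> S" "t \<in> S" using h by auto
  then have "braid_step y z"
    unfolding braid_step_def using h m_eq_2_neq
    by (intro exI[of _ u] exI[of _ v] exI[of _ s] exI[of _ t] exI[of _ 2])
      (auto simp: numeral_2_eq_2 numeral_eq_enat)
  then show ?case using step unfolding braid_eq_def by (meson rtranclp.rtrancl_into_rtrancl)
qed simp

lemma ceq_if_comm_eq: "comm_eq m x y \<Longrightarrow> x \<in> lists S \<Longrightarrow> ceq x y"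
  using braid_eq_if_comm_eq ceq_if_braid_eq by blast

text \<open>The factors that make a word non-reduced (\<open>s s\<close>) or non-fully-commutative (a braid
  word \<open>s t s \<dots>\<close> of length \<open>m\<^sub>s\<^sub>t \<ge> 3\<close>).\<close>

definition forbidden :: "'a list \<Rightarrow> bool" where
  "forbidden g \<longleftrightarrow> (\<exists>s\<in>S. g = [s, s])
     \<or> (\<exists>s\<in>S. \<exists>t\<in>S. s \<noteq> t \<and> (\<exists>M. m s t = enat M \<and> M \<ge> 3 \<and> g = alt s t M))"

definition avoids_forbidden :: "'a list \<Rightarrow> bool" where
  "avoids_forbidden w \<longleftrightarrow> w \<in> lists S \<and> (\<forall>x g y. comm_eq m w (x @ g @ y) \<longrightarrow> \<not> forbidden g)"

lemma comm_eq_if_braid_eq_avoids_forbidden: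
  assumes "avoids_forbidden w" "braid_eq w v"
  shows "comm_eq m w v"
  using assms(2) unfolding braid_eq_def
proof (induction rule: rtranclp_induct)
  case (step y z)
  from step(2) obtain p q s t M where h: "s \<in> S" "t \<in> S" "s \<noteq> t" "m s t = enat M"
    "y = p @ alt s t M @ q" "z = p @ alt t s M @ q"
    unfolding braid_step_def by blast
  have "M \<ge> 2" using m_enat_ge_2[OF h(1-4)] .
  show ?case
  proof (cases "M = 2")
    case True
    have "comm_step m y z"
      unfolding comm_step_def using h True
      by (intro exI[of _ p] exI[of _ q] exI[of _ s] exI[of _ t]) (auto simp: numeral_2_eq_2 numeral_eq_enat)
    then show ?thesis using step(3) unfolding comm_eq_def by (meson rtranclp.rtrancl_into_rtrancl)
  next
    case False
    then have "M \<ge> 3" using \<open>M \<ge> 2\<close> by simp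
    then have "forbidden (alt s t M)"
      unfolding forbidden_def using h(1-4) by blast
    then show ?thesis using assms(1) step(3) h unfolding avoids_forbidden_def comm_eq_def by blast
  qed
qed simp

lemma FC_reduced_word_if_avoids_forbidden:
  assumes g: "avoids_forbidden w"
  shows "w \<in> FC_reduced_words S m"
proof -
  have w: "w \<in> lists S" using g avoids_forbidden_def by auto
  have red: "reduced S m w"
  proof (rule ccontr)
    assume "\<not> reduced S m w"
    then obtain p q b where "b \<in> S" "braid_eq w (p @ [b, b] @ q)"
      using braid_eq_square_if_not_reduced w by blast
    then have "comm_eq m w (p @ [b, b] @ q)" "forbidden [b, b]"
      using comm_eq_if_braid_eq_avoids_forbidden g forbidden_def by auto
    then show False using g avoids_forbidden_def by blast
  qed
  have "comm_eq m u w" if "reduced S m u" "ceq u w" for u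
  proof -
    have "braid_eq w u" using matsumoto[OF red that(1) ceq_sym[OF that(2)]] .
    then show ?thesis using comm_eq_if_braid_eq_avoids_forbidden g comm_eq_sym w by blast
  qed
  then show ?thesis unfolding FC_reduced_words_def using red by blast
qed

lemma avoids_forbidden_if_FC_reduced_word:
  assumes w: "w \<in> FC_reduced_words S m"
  shows "avoids_forbidden w"
proof -
  have red: "reduced S m w" and fc: "\<And>u. reduced S m u \<Longrightarrow> ceq u w \<Longrightarrow> comm_eq m u w"
    using w unfolding FC_reduced_words_def by auto
  have wl: "w \<in> lists S" using red reduced_in_lists by auto
  have "\<not> forbidden g" if c: "comm_eq m w (x @ g @ y)" for x g y
  proof
    assume "forbidden g"
    let ?v = "x @ g @ y"
    have vl: "?v \<in> lists S" using comm_eq_in_lists c wl by blast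
    have cv: "ceq w ?v" using ceq_if_comm_eq c wl by blast
    have rv: "reduced S m ?v" using reduced_ceq_same_length[OF red cv] comm_eq_length[OF c] by simp
    show False using \<open>forbidden g\<close> unfolding forbidden_def
    proof (elim disjE bexE exE conjE)
      fix b assume b: "b \<in> S" "g = [b, b]"
      have "ceq ?v (x @ y)" using ceq_delete_square b vl by auto
      then have "length ?v \<le> length (x @ y)" using rv unfolding reduced_def by (blast intro: ceq_sym)
      then show False using b(2) by simp
    next
      text \<open>The braid move \<open>g \<mapsto> t s t \<dots>\<close> yields another reduced word of \<open>w\<close>; it is not
        commutation equivalent to \<open>w\<close> because the letters \<open>s, t\<close> occur in a different order.\<close>
      fix s t M assume h: "s \<in> S" "t \<in> S" "s \<noteq> t" "m s t = enat M" "3 \<le> M" "g = alt s t M"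
      let ?u = "x @ alt t s M @ y"
      have cu: "ceq ?v ?u" using ceq_cong[OF ceq_braid[OF h(1,2,4)]] vl h by simp
      have "reduced S m ?u" using reduced_ceq_same_length[OF rv cu] h(6) by simp
      then have "comm_eq m ?u w" using fc cv cu ceq_sym ceq_trans by blast
      then have "comm_eq m ?u ?v" using c comm_eq_trans by blast
      moreover have "m a b \<noteq> 2" if "a \<in> {s, t}" "b \<in> {s, t}" for a b
        using that h m_sym m_diag by (auto simp: numeral_eq_enat one_enat_def)
      ultimately have "filter (\<lambda>a. a \<in> {s, t}) ?u = filter (\<lambda>a. a \<in> {s, t}) ?v"
        using filter_pair_comm_eq[of s t m] by blast
      moreover have "filter (\<lambda>a. a \<in> {s, t}) (alt s t M) = alt s t M"
        "filter (\<lambda>a. a \<in> {s, t}) (alt t s M) = alt t s M"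
        using set_alt[of s t M] set_alt[of t s M] by (auto simp: filter_id_conv)
      ultimately have "alt t s M = alt s t M" using h(6) by simp
      then show False using h(3,5) by (cases M) auto
    qed
  qed
  then show ?thesis unfolding avoids_forbidden_def using wl by blast
qed

lemma FC_reduced_words_eq: "FC_reduced_words S m = {w. avoids_forbidden w}"
  using FC_reduced_word_if_avoids_forbidden avoids_forbidden_if_FC_reduced_word by blast

end

section \<open>A finite automaton for forbidden factors\<close>

lemma append_Cons_eq_append_Cons_Cons_cases:
  assumes "x0 @ a # y0 = u @ s # t # z"
  shows "(\<exists>x1. x0 = u @ s # t # x1 \<and> z = x1 @ a # y0)
    \<or> (x0 = u @ [s] \<and> t = a \<and> z = y0)
    \<or> (x0 = u \<and> s = a \<and> y0 = t # z)
    \<or> (\<exists>y1. u = x0 @ a # y1 \<and> y0 = y1 @ s # t # z)"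
  using assms
proof (induction u arbitrary: x0)
  case Nil
  then show ?case
  proof (cases x0)
    case (Cons c x0')
    then show ?thesis using Nil by (cases x0') auto
  qed simp
next
  case (Cons e u')
  then show ?case
  proof (cases x0)
    case (Cons c x0')
    then have "x0' @ a # y0 = u' @ s # t # z" "c = e" using Cons.prems by auto
    then show ?thesis using Cons.IH[of x0'] Cons by auto
  qed auto
qed

lemma append3_eq_append_Cons_cases:
  assumes "x @ g @ y = x0 @ a # y0"
  shows "(\<exists>x2. x = x0 @ a # x2 \<and> y0 = x2 @ g @ y)
    \<or> (\<exists>g1 g2. g = g1 @ a # g2 \<and> x0 = x @ g1 \<and> y0 = g2 @ y)
    \<or> (\<exists>y1 y2. y = y1 @ a # y2 \<and> x0 = x @ g @ y1 \<and> y0 = y2)"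
proof -
  obtain us where "(x = x0 @ us \<and> us @ g @ y = a # y0) \<or> (x @ us = x0 \<and> g @ y = us @ a # y0)"
    using append_eq_append_conv2[of x "g @ y" x0 "a # y0"] assms by auto
  then show ?thesis
  proof
    assume h: "x = x0 @ us \<and> us @ g @ y = a # y0"
    show ?thesis
    proof (cases us)
      case Nil
      then have gy: "g @ y = a # y0" "x = x0" using h by auto
      show ?thesis
      proof (cases g)
        case (Cons c g')
        then show ?thesis using gy by (intro disjI2 disjI1 exI[of _ "[]"] exI[of _ g']) auto
      qed (use gy in auto)
    qed (use h in auto)
  next
    assume h: "x @ us = x0 \<and> g @ y = us @ a # y0"
    then obtain vs where "(g = us @ vs \<and> vs @ y = a # y0) \<or> (g @ vs = us \<and> y = vs @ a # y0)"
      using append_eq_append_conv2[of g y us "a # y0"] by auto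
    then show ?thesis
    proof
      assume h': "g = us @ vs \<and> vs @ y = a # y0"
      show ?thesis
      proof (cases vs)
        case Nil
        then show ?thesis using h h' by (intro disjI2 exI[of _ "[]"] exI[of _ y0]) auto
      next
        case (Cons c vs')
        then show ?thesis using h h' by (intro disjI2 disjI1 exI[of _ us] exI[of _ vs']) auto
      qed
    next
      assume "g @ vs = us \<and> y = vs @ a # y0"
      then show ?thesis using h by (intro disjI2 exI[of _ vs] exI[of _ y0]) auto
    qed
  qed
qed

context coxeter_system
begin

lemma comm_eq_snoc_decompose:
  assumes "comm_eq m (w @ [a]) v" "w @ [a] \<in> lists S"
  shows "\<exists>x0 y0. v = x0 @ [a] @ y0 \<and> comm_eq m w (x0 @ y0) \<and> (\<forall>b\<in>set y0. m a b = 2)"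
  using assms unfolding comm_eq_def
proof (induction rule: rtranclp_induct)
  case base
  then show ?case by (intro exI[of _ w] exI[of _ "[]"]) simp
next
  case (step v v')
  obtain x0 y0 where h: "v = x0 @ [a] @ y0" "(comm_step m)\<^sup>*\<^sup>* w (x0 @ y0)" "\<forall>b\<in>set y0. m a b = 2"
    using step.IH step.prems by blast
  have vl: "v \<in> lists S" using comm_eq_in_lists step unfolding comm_eq_def by blast
  obtain u s t z where st: "m s t = 2" "v = u @ [s, t] @ z" "v' = u @ [t, s] @ z"
    using step(2) unfolding comm_step_def by blast
  have "s \<in> S" "t \<in> S" using vl unfolding st(2) by simp_all
  moreover have "a \<in> S" using vl unfolding h(1) by simp
  ultimately have S: "s \<in> S" "t \<in> S" "a \<in> S" by simp_all
  have "x0 @ a # y0 = u @ s # t # z" using h(1) st(2) by simp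
  note cases = append_Cons_eq_append_Cons_Cons_cases[OF this]
  consider (before) x1 where "x0 = u @ s # t # x1" "z = x1 @ a # y0"
    | (right) "x0 = u @ [s]" "t = a" "z = y0"
    | (left) "x0 = u" "s = a" "y0 = t # z"
    | (after) y1 where "u = x0 @ a # y1" "y0 = y1 @ s # t # z"
    using cases by blast
  then show ?case
  proof cases
    case before
    have "comm_step m (x0 @ y0) ((u @ [t, s] @ x1) @ y0)" unfolding comm_step_def using before st by auto
    then show ?thesis using h before st by (intro exI[of _ "u @ [t, s] @ x1"] exI[of _ y0]) auto
  next
    case right
    have "m a s = 2" using st right m_sym S by auto
    then show ?thesis using h right st by (intro exI[of _ u] exI[of _ "s # y0"]) auto
  next
    case left
    then show ?thesis using h st by (intro exI[of _ "u @ [t]"] exI[of _ z]) auto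
  next
    case after
    have "comm_step m (x0 @ y0) (x0 @ y1 @ [t, s] @ z)" unfolding comm_step_def using after st
      by (intro exI[of _ "x0 @ y1"] exI[of _ z] exI[of _ s] exI[of _ t]) auto
    then show ?thesis using h after st by (intro exI[of _ x0] exI[of _ "y1 @ [t, s] @ z"]) auto
  qed
qed

lemma forbidden_adjacent_not_commuting:
  assumes "forbidden h" "h = p @ [a, b] @ q"
  shows "m a b \<noteq> 2"
  using assms(1) unfolding forbidden_def
proof (elim disjE bexE exE conjE)
  fix s assume s: "s \<in> S" "h = [s, s]"
  then have "a = s" "b = s" using assms(2) by (cases p; auto)+
  then show ?thesis using m_diag s by (simp add: one_enat_def numeral_eq_enat)
next
  fix s t M assume h: "s \<in> S" "t \<in> S" "s \<noteq> t" "m s t = enat M" "3 \<le> M" "h = alt s t M"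
  then have "(a = s \<and> b = t) \<or> (a = t \<and> b = s)" using alt_adjacent assms(2) by metis
  then have "m a b = enat M" using h m_sym by auto
  then show ?thesis using h(5) by (simp add: numeral_eq_enat)
qed

definition forbidden_prefixes :: "'a list set" where
  "forbidden_prefixes = {g. \<exists>h. forbidden (g @ h)}"

text \<open>The state of the automaton after reading \<open>w\<close>: all occurrences \<open>x g y\<close> of prefixes \<open>g\<close>
  of forbidden factors in words commutation equivalent to \<open>w\<close>, with the set of letters of \<open>y\<close>.\<close>

definition occurrences :: "'a list \<Rightarrow> ('a list \<times> 'a set) set" where
  "occurrences w = {(g, Y). g \<in> forbidden_prefixes \<and> (\<exists>x y. comm_eq m w (x @ g @ y) \<and> set y = Y)}"

text \<open>A new last letter \<open>a\<close> commutes leftwards into \<open>y\<close>; it extends \<open>g\<close> if it commutes with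
  all of \<open>y\<close>, otherwise it stays inside \<open>y\<close>, or it passes \<open>g\<close> entirely.\<close>

definition occurrences_step :: "('a list \<times> 'a set) set \<Rightarrow> 'a \<Rightarrow> ('a list \<times> 'a set) set" where
  "occurrences_step R a = {(g @ [a], Y) | g Y. (g, Y) \<in> R \<and> (\<forall>b\<in>Y. m a b = 2) \<and> g @ [a] \<in> forbidden_prefixes}
     \<union> {(g, insert a Y) | g Y. (g, Y) \<in> R}
     \<union> {p \<in> R. \<forall>b \<in> set (fst p) \<union> snd p. m a b = 2}"

lemma occurrences_snoc_subset:
  assumes wa: "w @ [a] \<in> lists S"
  shows "occurrences (w @ [a]) \<subseteq> occurrences_step (occurrences w) a"
proof
  fix p assume "p \<in> occurrences (w @ [a])"
  then obtain g x y where p: "p = (g, set y)" "g \<in> forbidden_prefixes" "comm_eq m (w @ [a]) (x @ g @ y)"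
    unfolding occurrences_def by blast
  obtain x0 y0 where d: "x @ g @ y = x0 @ [a] @ y0" "comm_eq m w (x0 @ y0)" "\<forall>b\<in>set y0. m a b = 2"
    using comm_eq_snoc_decompose[OF p(3) wa] by blast
  consider (before) x2 where "x = x0 @ a # x2" "y0 = x2 @ g @ y"
    | (inside) g1 g2 where "g = g1 @ a # g2" "x0 = x @ g1" "y0 = g2 @ y"
    | (after) y1 y2 where "y = y1 @ a # y2" "x0 = x @ g @ y1" "y0 = y2"
    using append3_eq_append_Cons_cases[of x g y x0 a y0] d(1) by auto
  then show "p \<in> occurrences_step (occurrences w) a"
  proof cases
    case before
    have "comm_eq m w ((x0 @ x2) @ g @ y)" using d before by simp
    then have "(g, set y) \<in> occurrences w" unfolding occurrences_def using p by blast
    moreover have "\<forall>b \<in> set g \<union> set y. m a b = 2" using d(3) before by auto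
    ultimately show ?thesis using p unfolding occurrences_step_def by auto
  next
    case inside
    obtain h where h: "forbidden (g @ h)" using p(2) unfolding forbidden_prefixes_def by blast
    text \<open>\<open>a\<close> is the last letter of \<open>g\<close>, since it commutes with all letters after it
      while adjacent letters of a forbidden factor do not commute.\<close>
    have g2: "g2 = []"
    proof (rule ccontr)
      assume "g2 \<noteq> []"
      then obtain b g3 where g3: "g2 = b # g3" by (cases g2) auto
      then have "m a b = 2" using d(3) inside by auto
      moreover have "g @ h = g1 @ [a, b] @ (g3 @ h)" using inside g3 by simp
      ultimately show False using forbidden_adjacent_not_commuting h by blast
    qed
    have "g1 \<in> forbidden_prefixes"
      unfolding forbidden_prefixes_def using h inside g2 by (intro CollectI exI[of _ "[a] @ h"]) simp
    moreover have "comm_eq m w (x @ g1 @ y)" using d inside g2 by simp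
    ultimately have "(g1, set y) \<in> occurrences w" unfolding occurrences_def by blast
    moreover have "\<forall>b\<in>set y. m a b = 2" using d(3) inside by auto
    ultimately show ?thesis
      using p inside g2 unfolding occurrences_step_def by blast
  next
    case after
    have "comm_eq m w (x @ g @ (y1 @ y2))" using d after by simp
    then have "(g, set (y1 @ y2)) \<in> occurrences w" unfolding occurrences_def using p by blast
    moreover have "set y = insert a (set (y1 @ y2))" using after by auto
    ultimately show ?thesis using p unfolding occurrences_step_def by blast
  qed
qed

lemma occurrences_step_subset:
  assumes wa: "w @ [a] \<in> lists S"
  shows "occurrences_step (occurrences w) a \<subseteq> occurrences (w @ [a])"
proof
  have w: "w \<in> lists S" and a: "a \<in> S" using wa by auto
  have commute: "\<forall>b\<in>set y. m b a = 2" if "\<forall>b\<in>set y. m a b = 2" "comm_eq m w (x @ y)" for x y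
  proof
    fix b assume b: "b \<in> set y"
    have "y \<in> lists S" using comm_eq_in_lists[OF that(2) w] by simp
    then have "m b a = m a b" using m_sym[of b a] a b by auto
    then show "m b a = 2" using that(1) b by simp
  qed
  fix p assume "p \<in> occurrences_step (occurrences w) a"
  then consider (extend) g Y where "p = (g @ [a], Y)" "(g, Y) \<in> occurrences w" "\<forall>b\<in>Y. m a b = 2"
      "g @ [a] \<in> forbidden_prefixes"
    | (append) g Y where "p = (g, insert a Y)" "(g, Y) \<in> occurrences w"
    | (pass) "p \<in> occurrences w" "\<forall>b \<in> set (fst p) \<union> snd p. m a b = 2"
    unfolding occurrences_step_def by blast
  then show "p \<in> occurrences (w @ [a])"
  proof cases
    case extend
    then obtain x y where xy: "comm_eq m w ((x @ g) @ y)" "set y = Y" unfolding occurrences_def by auto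
    have "\<forall>b\<in>set y. m b a = 2" using commute[OF _ xy(1)] extend(3) xy(2) by blast
    then have "comm_eq m ((x @ g) @ y @ [a]) ((x @ g) @ [a] @ y)"
      by (rule comm_eq_move_left)
    then have "comm_eq m (w @ [a]) (x @ (g @ [a]) @ y)"
      using comm_eq_trans[OF comm_eq_snoc[OF xy(1)]] by simp
    then show ?thesis unfolding occurrences_def using extend xy by blast
  next
    case append
    then obtain x y where xy: "comm_eq m w (x @ g @ y)" "set y = Y" "g \<in> forbidden_prefixes"
      unfolding occurrences_def by blast
    have "comm_eq m (w @ [a]) (x @ g @ (y @ [a]))" using comm_eq_snoc[OF xy(1)] by simp
    then show ?thesis unfolding occurrences_def using append xy by fastforce
  next
    case pass
    obtain g Y where gY: "p = (g, Y)" by force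
    then obtain x y where xy: "comm_eq m w (x @ (g @ y))" "set y = Y" "g \<in> forbidden_prefixes"
      using pass unfolding occurrences_def by blast
    have "\<forall>b\<in>set (g @ y). m a b = 2" using pass(2) gY xy(2) by auto
    then have "\<forall>b\<in>set (g @ y). m b a = 2" using commute[OF _ xy(1)] by blast
    then have "comm_eq m (x @ (g @ y) @ [a]) (x @ [a] @ (g @ y))"
      by (rule comm_eq_move_left)
    then have "comm_eq m (w @ [a]) ((x @ [a]) @ g @ y)"
      using comm_eq_trans[OF comm_eq_snoc[OF xy(1)]] by simp
    then show ?thesis unfolding occurrences_def using gY xy by blast
  qed
qed

lemma occurrences_snoc: "w @ [a] \<in> lists S \<Longrightarrow> occurrences (w @ [a]) = occurrences_step (occurrences w) a"
  using occurrences_snoc_subset occurrences_step_subset by blast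

lemma foldl_occurrences_step: "w \<in> lists S \<Longrightarrow> foldl occurrences_step (occurrences []) w = occurrences w"
  by (induction w rule: rev_induct) (simp_all add: occurrences_snoc)

lemma avoids_forbidden_iff_occurrences:
  "avoids_forbidden w \<longleftrightarrow> w \<in> lists S \<and> (\<forall>p\<in>occurrences w. \<not> forbidden (fst p))"
proof -
  have "forbidden g \<Longrightarrow> g \<in> forbidden_prefixes" for g
    unfolding forbidden_prefixes_def by (intro CollectI exI[of _ "[]"]) simp
  then show ?thesis unfolding avoids_forbidden_def occurrences_def by fastforce
qed

lemma finite_forbidden: "finite {g. forbidden g}"
proof -
  let ?braid = "\<lambda>p. alt (fst p) (snd p) (the_enat (m (fst p) (snd p)))"
  have "{g. forbidden g} \<subseteq> (\<lambda>s. [s, s]) ` S \<union> ?braid ` (S \<times> S)"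
  proof
    fix g assume "g \<in> {g. forbidden g}"
    then show "g \<in> (\<lambda>s. [s, s]) ` S \<union> ?braid ` (S \<times> S)"
      unfolding forbidden_def
    proof (elim CollectE disjE bexE exE conjE)
      fix s t M assume h: "s \<in> S" "t \<in> S" "m s t = enat M" "g = alt s t M"
      then have "g = ?braid (s, t)" by simp
      then show ?thesis using h by blast
    qed blast
  qed
  moreover have "finite ((\<lambda>s. [s, s]) ` S \<union> ?braid ` (S \<times> S))"
    using finite_S by simp
  ultimately show ?thesis by (rule finite_subset)
qed

lemma finite_forbidden_prefixes: "finite forbidden_prefixes"
proof -
  have "forbidden_prefixes \<subseteq> (\<Union>h\<in>{g. forbidden g}. (\<lambda>n. take n h) ` {..length h})"
  proof
    fix g assume "g \<in> forbidden_prefixes"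
    then obtain h where h: "forbidden (g @ h)" unfolding forbidden_prefixes_def by blast
    then have "g = take (length g) (g @ h)" "length g \<le> length (g @ h)" by simp_all
    then show "g \<in> (\<Union>h\<in>{g. forbidden g}. (\<lambda>n. take n h) ` {..length h})" using h by blast
  qed
  moreover have "finite (\<Union>h\<in>{g. forbidden g}. (\<lambda>n. take n h) ` {..length h})"
    using finite_forbidden by auto
  ultimately show ?thesis by (rule finite_subset)
qed

definition state_space :: "('a list \<times> 'a set) set set" where
  "state_space = Pow (forbidden_prefixes \<times> Pow S)"

lemma finite_state_space: "finite state_space"
  unfolding state_space_def using finite_forbidden_prefixes finite_S by simp

lemma occurrences_in_state_space: "w \<in> lists S \<Longrightarrow> occurrences w \<in> state_space"
  unfolding state_space_def occurrences_def using comm_eq_in_lists by fastforce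

lemma occurrences_step_in_state_space: "R \<in> state_space \<Longrightarrow> a \<in> S \<Longrightarrow> occurrences_step R a \<in> state_space"
  unfolding state_space_def occurrences_step_def by auto

end

section \<open>Regularity\<close>

lemma regular_lang_if_finite_automaton:
  fixes \<delta> :: "'q \<Rightarrow> 'a \<Rightarrow> 'q"
  assumes "finite Q" "q0 \<in> Q" "\<And>q a. q \<in> Q \<Longrightarrow> a \<in> \<Sigma> \<Longrightarrow> \<delta> q a \<in> Q"
    and L: "L = {w \<in> lists \<Sigma>. foldl \<delta> q0 w \<in> F}"
  shows "regular_lang \<Sigma> L"
proof -
  obtain enc :: "'q \<Rightarrow> nat" and n where enc: "enc ` Q = {i. i < n}" "inj_on enc Q"
    using finite_imp_inj_to_nat_seg[OF assms(1)] by blast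
  define dec where "dec = the_inv_into Q enc"
  have dec_enc: "dec (enc q) = q" if "q \<in> Q" for q
    unfolding dec_def using the_inv_into_f_f[OF enc(2) that] .
  define \<delta>' where "\<delta>' i a = enc (\<delta> (dec i) a)" for i a
  have run: "foldl \<delta>' (enc q0) w = enc (foldl \<delta> q0 w) \<and> foldl \<delta> q0 w \<in> Q" if "w \<in> lists \<Sigma>" for w
    using that
  proof (induction w rule: rev_induct)
    case (snoc a w)
    then show ?case unfolding \<delta>'_def using dec_enc assms(3) by auto
  qed (simp add: assms(2))
  have "foldl \<delta>' (enc q0) w \<in> enc ` (F \<inter> Q) \<longleftrightarrow> foldl \<delta> q0 w \<in> F" if "w \<in> lists \<Sigma>" for w
    using run[OF that] by (auto simp: inj_on_image_mem_iff[OF enc(2)])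
  then have "L = {w \<in> lists \<Sigma>. foldl \<delta>' (enc q0) w \<in> enc ` (F \<inter> Q)}"
    unfolding L by auto
  moreover have "\<forall>i\<in>enc ` Q. \<forall>a\<in>\<Sigma>. \<delta>' i a \<in> enc ` Q"
    unfolding \<delta>'_def using dec_enc assms(3) by auto
  ultimately show ?thesis
    unfolding regular_lang_def using assms(1,2)
    by (intro exI[of _ "enc ` Q"] exI[of _ "enc q0"] exI[of _ \<delta>'] exI[of _ "enc ` (F \<inter> Q)"]) auto
qed

theorem theorem3p5:
  fixes S :: "'a set" and m :: "'a \<Rightarrow> 'a \<Rightarrow> enat"
  assumes "coxeter_matrix S m"
  shows "regular_lang S (FC_reduced_words S m)"
proof -
  interpret coxeter_system S m by (rule coxeter_system.intro[OF assms])
  show ?thesis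
  proof (rule regular_lang_if_finite_automaton)
    show "finite state_space" by (rule finite_state_space)
    show "occurrences [] \<in> state_space" by (simp add: occurrences_in_state_space)
    show "\<And>R a. R \<in> state_space \<Longrightarrow> a \<in> S \<Longrightarrow> occurrences_step R a \<in> state_space"
      by (rule occurrences_step_in_state_space)
    show "FC_reduced_words S m = {w \<in> lists S.
        foldl occurrences_step (occurrences []) w \<in> {R. \<forall>p\<in>R. \<not> forbidden (fst p)}}"
      unfolding FC_reduced_words_eq avoids_forbidden_iff_occurrences
      using foldl_occurrences_step by fastforce
  qed
qed

end
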